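(* There exist a universal constant $c>0$ and a universal $\underline n$ such that for all $n\ge\underline n$, all $2\le k\le n$ and all $\sigma>0$, $$\inf_{\widetilde\theta^*}\sup_{\theta^*\in\Theta_n^*(1,k)}\mathbb E_{\theta^*}\|\widetilde\theta^*-\theta^*\|^2\ge c\,\sigma^2k\log\log(16n/k),$$ where under $\mathbb E_{\theta^*}$ one observes $Y=\theta^*+\varepsilon$ with $\varepsilon_1,\dots,\varepsilon_n$ i.i.d. $N(0,\sigma^2)$, and the infimum is over all measurable functions $\widetilde\theta^*=\widetilde\theta^*(Y)\in\mathbb R^n$ of $Y$.
   Context: $\|\cdot\|$ is the Euclidean norm. $\mathcal F_n(1,0,k)$ is the set of functions $f:[0,1]\to\mathbb R$ for which there exist integers $0=n_0\le n_1\le\cdots\le n_k=n$ such that $n_i-n_{i-1}\ge 2$ whenever $n_i>n_{i-1}$, $f$ is affine on each interval $(n_{i-1}/n,n_i/n]$, and $f((n_i/n)_-)=f((n_i/n)_+)$ for all $i\in\{1,\dots,k-1\}$ with $0<n_i<n$. $\mathcal F_n^*(1,k)$ is the set of $f\in\mathcal F_n(1,0,k)$ whose slopes are non-decreasing on $[0,1]$ (convex piecewise linear functions). $\Theta_n^*(1,k)=\{\theta^*\in\mathbb R^n:\theta^*_i=f^*(i/n),\ 1\le i\le n,\text{ for some }f^*\in\mathcal F_n^*(1,k)\}$. *)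

theory Defs
  imports "HOL-Probability.Probability"
begin

text \<open>Since the dimension n is quantified inside the theorem, vectors of length n are
  functions in \<open>{1..n} \<rightarrow>\<^sub>E UNIV\<close>.  Functions on the unit interval are
  total functions that are \<open>undefined\<close> outside \<open>{0..1}\<close>.\<close>

definition affine_with_slope :: "(real \<Rightarrow> real) \<Rightarrow> real \<Rightarrow> real set \<Rightarrow> bool" where
  "affine_with_slope f b S \<longleftrightarrow> (\<exists>a. \<forall>x\<in>S. f x = a + b * x)"

text \<open>Repeated knots are allowed and give empty pieces, so k bounds the number of pieces.
  The value at 0 lies in no piece and is therefore unconstrained.\<close>

definition pw_linear_class :: "nat \<Rightarrow> nat \<Rightarrow> (real \<Rightarrow> real) set" where
  "pw_linear_class n k = {f \<in> extensional {0..1}. \<exists>\<nu> :: nat \<Rightarrow> nat.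
     \<nu> 0 = 0 \<and> \<nu> k = n \<and>
     (\<forall>i\<in>{1..k}. \<nu> (i - 1) \<le> \<nu> i \<and> (\<nu> (i - 1) < \<nu> i \<longrightarrow> \<nu> i - \<nu> (i - 1) \<ge> 2)) \<and>
     (\<forall>i\<in>{1..k}. \<exists>b. affine_with_slope f b {real (\<nu> (i - 1)) / real n <.. real (\<nu> i) / real n}) \<and>
     (\<forall>i\<in>{1..k - 1}. 0 < \<nu> i \<and> \<nu> i < n \<longrightarrow>
        (\<exists>l. (f \<longlongrightarrow> l) (at_left (real (\<nu> i) / real n)) \<and>
             (f \<longlongrightarrow> l) (at_right (real (\<nu> i) / real n))))}"

definition slopes_nondecreasing :: "(real \<Rightarrow> real) \<Rightarrow> bool" where
  "slopes_nondecreasing f \<longleftrightarrow>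
     (\<forall>u v s t b b'. 0 \<le> u \<and> u < v \<and> v \<le> s \<and> s < t \<and> t \<le> 1 \<and>
        affine_with_slope f b {u<..v} \<and> affine_with_slope f b' {s<..t} \<longrightarrow> b \<le> b')"

definition convex_pw_linear_class :: "nat \<Rightarrow> nat \<Rightarrow> (real \<Rightarrow> real) set" where
  "convex_pw_linear_class n k = {f \<in> pw_linear_class n k. slopes_nondecreasing f}"

definition Theta_star :: "nat \<Rightarrow> nat \<Rightarrow> (nat \<Rightarrow> real) set" where
  "Theta_star n k = {\<theta> \<in> {1..n} \<rightarrow>\<^sub>E UNIV.
     \<exists>f\<in>convex_pw_linear_class n k. \<forall>i\<in>{1..n}. \<theta> i = f (real i / real n)}"

abbreviation vec_borel :: "nat \<Rightarrow> (nat \<Rightarrow> real) measure" where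
  "vec_borel n \<equiv> Pi\<^sub>M {1..n} (\<lambda>_. borel)"

definition gaussian_noise :: "nat \<Rightarrow> real \<Rightarrow> (nat \<Rightarrow> real) measure" where
  "gaussian_noise n \<sigma> = Pi\<^sub>M {1..n} (\<lambda>_. density lborel (normal_density 0 \<sigma>))"

definition observation :: "nat \<Rightarrow> real \<Rightarrow> (nat \<Rightarrow> real) \<Rightarrow> (nat \<Rightarrow> real) measure" where
  "observation n \<sigma> \<theta> =
     distr (gaussian_noise n \<sigma>) (vec_borel n) (\<lambda>\<epsilon>. \<lambda>i\<in>{1..n}. \<theta> i + \<epsilon> i)"

definition estimators :: "nat \<Rightarrow> ((nat \<Rightarrow> real) \<Rightarrow> (nat \<Rightarrow> real)) set" where
  "estimators n = vec_borel n \<rightarrow>\<^sub>M vec_borel n"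

text \<open>A nonnegative integral in \<open>ennreal\<close>, so that an estimator whose squared error
  is not integrable has infinite risk.\<close>

definition sq_risk ::
  "nat \<Rightarrow> real \<Rightarrow> ((nat \<Rightarrow> real) \<Rightarrow> (nat \<Rightarrow> real)) \<Rightarrow> (nat \<Rightarrow> real) \<Rightarrow> ennreal" where
  "sq_risk n \<sigma> T \<theta> =
     (\<integral>\<^sup>+ y. ennreal ((L2_set (\<lambda>i. T y i - \<theta> i) {1..n})\<^sup>2) \<partial>observation n \<sigma> \<theta>)"

end

(* Around every centre of an equispaced grid, the steep convex function A |x - c| can be
   perturbed by a hat of any width w in a sparse geometric scale without losing convexity,
   because its kink at c absorbs the concave kink of the hat; each perturbation costs three
   pieces.  With about k centres and J widths, where J is of order sqrt (log (n / k)), the hats at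
   one centre, normalised to squared norm of order sigma^2 log J, are nearly orthogonal.  Hence the
   uniform mixture over the widths has bounded chi-square distance to the absence of a hat, so no
   estimator can detect the hat and each centre contributes sigma^2 log J to the Bayes risk. *)

theory Submission
  imports Defs
begin

subsection \<open>Gaussian likelihoods\<close>


text \<open>The iterated logarithm is the price of not knowing the width. Of the J^2 terms in the
  second moment of the averaged likelihood ratio only the J diagonal ones contain exp (squared norm
  / \<sigma>^2), so a squared norm of order \<sigma>^2 ln J goes unnoticed. Spacing the widths by 4
  ^ J keeps only about the square root of the number of available geometric scales, but ln J still
  has the order of ln ln (n / k), and the off-diagonal inner products drop below \<sigma>^2 / 2.

  The obstacle is that the base function must be the same for all widths, while convexity limits
  each perturbation. One slope A serves them all, because the narrowest hat is also the tallest. A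
  large A costs nothing: only differences of mean vectors enter the risk comparison.

  No testing error or total variation distance is computed; a pointwise inequality between densities
  and losses is integrated instead. Since an estimator sees all observations, the bound at one
  centre is proved for arbitrary fixed hats elsewhere, and averaging over all configurations then
  adds up the centres.\<close>

definition gaussian_density :: "nat \<Rightarrow> real \<Rightarrow> (nat \<Rightarrow> real) \<Rightarrow> (nat \<Rightarrow> real) \<Rightarrow> real" where
  "gaussian_density n \<sigma> \<theta> y = (\<Prod>i\<in>{1..n}. normal_density (\<theta> i) \<sigma> (y i))"

abbreviation lborel_vec :: "nat \<Rightarrow> (nat \<Rightarrow> real) measure" where
  "lborel_vec n \<equiv> Pi\<^sub>M {1..n} (\<lambda>_. lborel)"

lemma sets_lborel_vec [measurable_cong]: "sets (lborel_vec n) = sets (vec_borel n)"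
  by (intro sets_PiM_cong) auto

lemma borel_measurable_gaussian_density [measurable]:
  "gaussian_density n \<sigma> \<theta> \<in> borel_measurable (vec_borel n)"
  unfolding gaussian_density_def by measurable

lemma gaussian_density_pos: "\<sigma> > 0 \<Longrightarrow> 0 < gaussian_density n \<sigma> \<theta> y"
  unfolding gaussian_density_def by (intro prod_pos) (auto intro: normal_density_pos)

lemma gaussian_density_nonneg: "0 \<le> gaussian_density n \<sigma> \<theta> y"
  unfolding gaussian_density_def by (intro prod_nonneg) auto

lemma emeasure_shift_normal_density:
  assumes "A \<in> sets borel"
  shows "emeasure (density lborel (normal_density 0 \<sigma>)) ((+) \<mu> -` A)
    = emeasure (density lborel (normal_density \<mu> \<sigma>)) A"
proof -
  have [measurable]: "A \<in> sets borel" by fact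
  have V: "(+) \<mu> -` A \<in> sets borel"
    using measurable_sets[of "(+) \<mu>" borel borel A] by simp
  have "emeasure (density lborel (normal_density \<mu> \<sigma>)) A
      = (\<integral>\<^sup>+ x. ennreal (normal_density \<mu> \<sigma> x) * indicator A x \<partial>lborel)"
    by (subst emeasure_density) auto
  also have "\<dots> = (\<integral>\<^sup>+ x. ennreal (normal_density \<mu> \<sigma> (\<mu> + x)) * indicator A (\<mu> + x) \<partial>lborel)"
    by (subst nn_integral_real_affine[where c = 1 and t = \<mu>]) auto
  also have "\<dots> = (\<integral>\<^sup>+ x. ennreal (normal_density 0 \<sigma> x) * indicator ((+) \<mu> -` A) x \<partial>lborel)"
    by (intro nn_integral_cong) (auto simp: normal_density_def indicator_def)
  also have "\<dots> = emeasure (density lborel (normal_density 0 \<sigma>)) ((+) \<mu> -` A)"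
    using V by (subst emeasure_density) auto
  finally show ?thesis by simp
qed

text \<open>Both measures give a box the product of shifted Gaussian masses. With a common
  dominating measure, risks at different parameters can be compared under one integral.\<close>

lemma observation_eq_density:
  assumes \<sigma>: "\<sigma> > 0"
  shows "observation n \<sigma> \<theta> = density (lborel_vec n) (gaussian_density n \<sigma> \<theta>)"
proof -
  interpret N: product_sigma_finite "\<lambda>i. density lborel (normal_density (\<theta> i) \<sigma>)"
    by (intro product_sigma_finite.intro prob_space_imp_sigma_finite prob_space_normal_density \<sigma>)
  interpret N0: product_sigma_finite "\<lambda>i::nat. density lborel (normal_density 0 \<sigma>)"
    by (intro product_sigma_finite.intro prob_space_imp_sigma_finite prob_space_normal_density \<sigma>)
  interpret L: product_sigma_finite "\<lambda>i::nat. lborel :: real measure"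
    by standard
  have sets_N: "sets (Pi\<^sub>M {1..n} (\<lambda>i. density lborel (normal_density (\<mu> i) \<sigma>))) = sets (vec_borel n)"
    for \<mu> by (intro sets_PiM_cong) auto
  have sets_G: "sets (gaussian_noise n \<sigma>) = sets (vec_borel n)"
    unfolding gaussian_noise_def by (intro sets_PiM_cong) auto
  have "observation n \<sigma> \<theta> = Pi\<^sub>M {1..n} (\<lambda>i. density lborel (normal_density (\<theta> i) \<sigma>))"
  proof (rule N.PiM_eqI)
    fix A assume "\<And>i. i \<in> {1..n} \<Longrightarrow> A i \<in> sets (density lborel (normal_density (\<theta> i) \<sigma>))"
    then have A: "\<And>i. i \<in> {1..n} \<Longrightarrow> A i \<in> sets borel" by simp
    have V: "(+) (\<theta> i) -` A i \<in> sets borel" if "i \<in> {1..n}" for i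
      using measurable_sets[of "(+) (\<theta> i)" borel borel "A i"] A[OF that] by simp
    have shift: "(\<lambda>\<epsilon>. \<lambda>i\<in>{1..n}. \<theta> i + \<epsilon> i) \<in> measurable (gaussian_noise n \<sigma>) (vec_borel n)"
      unfolding measurable_cong_sets[OF sets_G refl] by measurable
    have "emeasure (observation n \<sigma> \<theta>) (Pi\<^sub>E {1..n} A)
      = emeasure (gaussian_noise n \<sigma>)
          ((\<lambda>\<epsilon>. \<lambda>i\<in>{1..n}. \<theta> i + \<epsilon> i) -` Pi\<^sub>E {1..n} A \<inter> space (gaussian_noise n \<sigma>))"
      unfolding observation_def using A by (intro emeasure_distr[OF shift] sets_PiM_I_finite) auto
    also have "(\<lambda>\<epsilon>. \<lambda>i\<in>{1..n}. \<theta> i + \<epsilon> i) -` Pi\<^sub>E {1..n} A \<inter> space (gaussian_noise n \<sigma>)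
      = Pi\<^sub>E {1..n} (\<lambda>i. (+) (\<theta> i) -` A i)"
      by (auto simp: gaussian_noise_def space_PiM PiE_def Pi_def extensional_def)
    also have "emeasure (gaussian_noise n \<sigma>) \<dots>
        = (\<Prod>i\<in>{1..n}. emeasure (density lborel (normal_density 0 \<sigma>)) ((+) (\<theta> i) -` A i))"
      unfolding gaussian_noise_def using V by (intro N0.emeasure_PiM) auto
    also have "\<dots> = (\<Prod>i\<in>{1..n}. emeasure (density lborel (normal_density (\<theta> i) \<sigma>)) (A i))"
      using A by (intro prod.cong refl emeasure_shift_normal_density) auto
    finally show "emeasure (observation n \<sigma> \<theta>) (Pi\<^sub>E {1..n} A)
      = (\<Prod>i\<in>{1..n}. emeasure (density lborel (normal_density (\<theta> i) \<sigma>)) (A i))" .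
  qed (simp_all only: finite_atLeastAtMost sets_N, simp add: observation_def)
  also have "\<dots> = density (lborel_vec n) (gaussian_density n \<sigma> \<theta>)"
  proof (rule N.PiM_eqI[symmetric])
    fix A assume "\<And>i. i \<in> {1..n} \<Longrightarrow> A i \<in> sets (density lborel (normal_density (\<theta> i) \<sigma>))"
    then have A: "\<And>i. i \<in> {1..n} \<Longrightarrow> A i \<in> sets borel" by simp
    then have AP: "Pi\<^sub>E {1..n} A \<in> sets (lborel_vec n)"
      by (intro sets_PiM_I_finite) auto
    have "emeasure (density (lborel_vec n) (gaussian_density n \<sigma> \<theta>)) (Pi\<^sub>E {1..n} A)
      = (\<integral>\<^sup>+ y. ennreal (gaussian_density n \<sigma> \<theta> y) * indicator (Pi\<^sub>E {1..n} A) y \<partial>lborel_vec n)"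
      by (rule emeasure_density[OF _ AP]) measurable
    also have "\<dots> = (\<integral>\<^sup>+ y. (\<Prod>i\<in>{1..n}. ennreal (normal_density (\<theta> i) \<sigma> (y i)) * indicator (A i) (y i))
        \<partial>lborel_vec n)"
    proof (intro nn_integral_cong)
      fix y :: "nat \<Rightarrow> real" assume "y \<in> space (lborel_vec n)"
      then have "indicator (Pi\<^sub>E {1..n} A) y = (\<Prod>i\<in>{1..n}. indicator (A i) (y i) :: ennreal)"
        by (auto simp: indicator_def space_PiM PiE_def Pi_def)
      then show "ennreal (gaussian_density n \<sigma> \<theta> y) * indicator (Pi\<^sub>E {1..n} A) y
        = (\<Prod>i\<in>{1..n}. ennreal (normal_density (\<theta> i) \<sigma> (y i)) * indicator (A i) (y i))"
        by (simp add: gaussian_density_def prod_ennreal prod.distrib)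
    qed
    also have "\<dots> = (\<Prod>i\<in>{1..n}. \<integral>\<^sup>+ x. ennreal (normal_density (\<theta> i) \<sigma> x) * indicator (A i) x \<partial>lborel)"
      using A by (intro L.product_nn_integral_prod) auto
    also have "\<dots> = (\<Prod>i\<in>{1..n}. emeasure (density lborel (normal_density (\<theta> i) \<sigma>)) (A i))"
      using A by (intro prod.cong refl emeasure_density[symmetric]) auto
    finally show "emeasure (density (lborel_vec n) (gaussian_density n \<sigma> \<theta>)) (Pi\<^sub>E {1..n} A)
      = (\<Prod>i\<in>{1..n}. emeasure (density lborel (normal_density (\<theta> i) \<sigma>)) (A i))" .
  qed (simp_all only: finite_atLeastAtMost sets_N sets_density sets_lborel_vec)
  finally show ?thesis .
qed

lemma nn_integral_gaussian_density:
  assumes "\<sigma> > 0"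
  shows "(\<integral>\<^sup>+ y. ennreal (gaussian_density n \<sigma> \<theta> y) \<partial>lborel_vec n) = 1"
proof -
  interpret L: product_sigma_finite "\<lambda>i::nat. lborel :: real measure"
    by standard
  have "(\<integral>\<^sup>+ y. ennreal (gaussian_density n \<sigma> \<theta> y) \<partial>lborel_vec n)
      = (\<integral>\<^sup>+ y. (\<Prod>i\<in>{1..n}. ennreal (normal_density (\<theta> i) \<sigma> (y i))) \<partial>lborel_vec n)"
    by (simp add: gaussian_density_def prod_ennreal)
  also have "\<dots> = (\<Prod>i\<in>{1..n}. \<integral>\<^sup>+ x. ennreal (normal_density (\<theta> i) \<sigma> x) \<partial>lborel)"
    by (intro L.product_nn_integral_prod) auto
  also have "\<dots> = 1"
    using assms by (intro prod.neutral ballI) (simp add: nn_integral_eq_integral)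
  finally show ?thesis .
qed

text \<open>The centres \<open>c\<close> and \<open>a + b - c\<close> have the same sum as
  \<open>a\<close> and \<open>b\<close>, so the exponents differ only by a constant. Dividing by the
  density at \<open>c\<close> thus leaves a scaled normal density, whose integral is known.\<close>

lemma normal_density_mult:
  assumes "\<sigma> > 0"
  shows "normal_density a \<sigma> x * normal_density b \<sigma> x
    = normal_density c \<sigma> x * normal_density (a + b - c) \<sigma> x * exp ((a - c) * (b - c) / \<sigma>\<^sup>2)"
proof -
  have "exp (- (x - a)\<^sup>2 / (2 * \<sigma>\<^sup>2)) * exp (- (x - b)\<^sup>2 / (2 * \<sigma>\<^sup>2))
      = exp (- (x - c)\<^sup>2 / (2 * \<sigma>\<^sup>2)) * exp (- (x - (a + b - c))\<^sup>2 / (2 * \<sigma>\<^sup>2))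
        * exp ((a - c) * (b - c) / \<sigma>\<^sup>2)"
    unfolding exp_add[symmetric] using assms
    by (intro arg_cong[of _ _ exp]) (simp add: field_simps, simp add: algebra_simps power2_eq_square)
  then show ?thesis by (simp add: normal_density_def)
qed

lemma gaussian_density_mult:
  assumes "\<sigma> > 0"
  shows "gaussian_density n \<sigma> \<theta>\<^sub>1 y * gaussian_density n \<sigma> \<theta>\<^sub>2 y
    = gaussian_density n \<sigma> \<theta>\<^sub>0 y * gaussian_density n \<sigma> (\<lambda>i. \<theta>\<^sub>1 i + \<theta>\<^sub>2 i - \<theta>\<^sub>0 i) y
      * exp ((\<Sum>i\<in>{1..n}. (\<theta>\<^sub>1 i - \<theta>\<^sub>0 i) * (\<theta>\<^sub>2 i - \<theta>\<^sub>0 i)) / \<sigma>\<^sup>2)"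
  unfolding gaussian_density_def sum_divide_distrib exp_sum[OF finite_atLeastAtMost] prod.distrib[symmetric]
  by (intro prod.cong refl normal_density_mult assms)

section \<open>Risk on a block of coordinates and its lower bound under a mixture\<close>

definition block_risk ::
  "nat \<Rightarrow> real \<Rightarrow> nat set \<Rightarrow> ((nat \<Rightarrow> real) \<Rightarrow> (nat \<Rightarrow> real)) \<Rightarrow> (nat \<Rightarrow> real) \<Rightarrow> ennreal" where
  "block_risk n \<sigma> S T \<theta> = (\<integral>\<^sup>+ y. ennreal (\<Sum>i\<in>S. (T y i - \<theta> i)\<^sup>2) \<partial>observation n \<sigma> \<theta>)"

lemma borel_measurable_component:
  assumes "T \<in> estimators n" "i \<in> {1..n}"
  shows "(\<lambda>y. T y i) \<in> borel_measurable (vec_borel n)"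
  using measurable_compose[OF _ measurable_component_singleton[OF assms(2)]] assms(1)
  unfolding estimators_def by blast

lemma sets_observation [measurable_cong]: "sets (observation n \<sigma> \<theta>) = sets (vec_borel n)"
  by (simp add: observation_def)

lemma block_risk_eq:
  assumes \<sigma>: "\<sigma> > 0" and T: "T \<in> estimators n" and S: "S \<subseteq> {1..n}"
  shows "block_risk n \<sigma> S T \<theta>
    = (\<integral>\<^sup>+ y. ennreal (gaussian_density n \<sigma> \<theta> y * (\<Sum>i\<in>S. (T y i - \<theta> i)\<^sup>2)) \<partial>lborel_vec n)"
proof -
  have [measurable]: "i \<in> S \<Longrightarrow> (\<lambda>y. T y i) \<in> borel_measurable (vec_borel n)" for i
    using S by (intro borel_measurable_component[OF T]) auto
  show ?thesis
    unfolding block_risk_def observation_eq_density[OF \<sigma>]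
    by (subst nn_integral_density)
      (measurable, simp add: ennreal_mult gaussian_density_nonneg sum_nonneg)
qed

lemma sum_block_risk_le_sq_risk:
  assumes T: "T \<in> estimators n" and I: "finite I" and S: "\<And>b. b \<in> I \<Longrightarrow> S b \<subseteq> {1..n}"
    and disj: "disjoint_family_on S I"
  shows "(\<Sum>b\<in>I. block_risk n \<sigma> (S b) T \<theta>) \<le> sq_risk n \<sigma> T \<theta>"
proof -
  have [measurable]: "b \<in> I \<Longrightarrow> i \<in> S b \<Longrightarrow> (\<lambda>y. T y i) \<in> borel_measurable (vec_borel n)" for b i
    using S[of b] by (intro borel_measurable_component[OF T]) auto
  have "(\<Sum>b\<in>I. block_risk n \<sigma> (S b) T \<theta>)
      = (\<integral>\<^sup>+ y. (\<Sum>b\<in>I. ennreal (\<Sum>i\<in>S b. (T y i - \<theta> i)\<^sup>2)) \<partial>observation n \<sigma> \<theta>)"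
    unfolding block_risk_def by (rule nn_integral_sum[symmetric]) measurable
  also have "\<dots> \<le> sq_risk n \<sigma> T \<theta>"
    unfolding sq_risk_def
  proof (rule nn_integral_mono)
    fix y
    have "(\<Sum>b\<in>I. \<Sum>i\<in>S b. (T y i - \<theta> i)\<^sup>2) = (\<Sum>i\<in>(\<Union>b\<in>I. S b). (T y i - \<theta> i)\<^sup>2)"
      using I S disj by (intro sum.UNION_disjoint[symmetric])
        (auto simp: disjoint_family_on_def intro: finite_subset[OF S])
    also have "\<dots> \<le> (\<Sum>i\<in>{1..n}. (T y i - \<theta> i)\<^sup>2)"
      using S by (intro sum_mono2) auto
    also have "\<dots> = (L2_set (\<lambda>i. T y i - \<theta> i) {1..n})\<^sup>2"
      by (simp add: L2_set_def sum_nonneg)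
    finally show "(\<Sum>b\<in>I. ennreal (\<Sum>i\<in>S b. (T y i - \<theta> i)\<^sup>2))
        \<le> ennreal ((L2_set (\<lambda>i. T y i - \<theta> i) {1..n})\<^sup>2)"
      by (simp add: sum_nonneg)
  qed
  finally show ?thesis .
qed

text \<open>Here \<open>p\<close> and \<open>q\<close> are null and mixture likelihoods,
  \<open>X\<close> is the null loss and \<open>Y\<close> the weighted alternative loss. The combined
  loss is at least \<open>D * min p q\<close>, and
  \<open>min p q \<ge> q - q\<^sup>2 / (4 * p)\<close> because a square is nonnegative. The
  quadratic form on the right is what a second moment controls.\<close>

lemma mixture_loss_pointwise:
  fixes p X D q Y :: real
  assumes "p > 0" "q \<ge> 0" "X \<ge> 0" "D \<ge> 0" "Y \<ge> 0" "Y \<ge> q * (D - X)"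
  shows "D * q \<le> p * X + Y + D * q\<^sup>2 / (4 * p)"
proof -
  have *: "p - q + q\<^sup>2 / (4 * p) = (2 * p - q)\<^sup>2 / (4 * p)"
    using assms(1) by (simp add: field_simps power2_eq_square)
  then have **: "p - q + q\<^sup>2 / (4 * p) \<ge> 0"
    using assms(1) by simp
  show ?thesis
  proof (cases "X \<ge> D")
    case True
    have "0 \<le> D * (p - q + q\<^sup>2 / (4 * p))" using ** assms by simp
    also have "\<dots> = D * p - D * q + D * q\<^sup>2 / (4 * p)" by (simp add: algebra_simps)
    also have "D * p \<le> p * X" using True assms by (simp add: mult.commute)
    finally show ?thesis using assms by linarith
  next
    case False
    have "0 \<le> X * (p - q + q\<^sup>2 / (4 * p))" using ** assms by simp
    also have "\<dots> = p * X - q * X + X * (q\<^sup>2 / (4 * p))" by (simp add: algebra_simps)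
    also have "X * (q\<^sup>2 / (4 * p)) \<le> D * (q\<^sup>2 / (4 * p))" using False assms by (intro mult_right_mono) auto
    finally show ?thesis using assms by (simp add: algebra_simps)
  qed
qed

text \<open>The second moment of the mixture of the likelihood ratios is the Gaussian Gram sum, since
  the product of two Gaussian densities over a third is again proportional to a Gaussian density.\<close>

lemma mixture_block_risk:
  fixes \<theta> :: "nat \<Rightarrow> nat \<Rightarrow> real"
  assumes \<sigma>: "\<sigma> > 0" and T: "T \<in> estimators n" and S: "S \<subseteq> {1..n}" and D: "D \<ge> 0"
    and sep: "\<And>j. j < J \<Longrightarrow> 2 * D \<le> (\<Sum>i\<in>S. (\<theta> j i - \<theta>\<^sub>0 i)\<^sup>2)"
    and gram: "(\<Sum>j<J. \<Sum>l<J. exp ((\<Sum>i\<in>{1..n}. (\<theta> j i - \<theta>\<^sub>0 i) * (\<theta> l i - \<theta>\<^sub>0 i)) / \<sigma>\<^sup>2))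
      \<le> 13 / 4 * (real J)\<^sup>2"
  shows "ennreal (3 / 16 * D * real J)
    \<le> of_nat J * block_risk n \<sigma> S T \<theta>\<^sub>0 + (\<Sum>j<J. block_risk n \<sigma> S T (\<theta> j))"
proof (cases "J = 0")
  case False
  define G where "G j l = exp ((\<Sum>i\<in>{1..n}. (\<theta> j i - \<theta>\<^sub>0 i) * (\<theta> l i - \<theta>\<^sub>0 i)) / \<sigma>\<^sup>2)" for j l
  define p where "p = gaussian_density n \<sigma> \<theta>\<^sub>0"
  define q where "q j = gaussian_density n \<sigma> (\<theta> j)" for j
  define r where "r j l = gaussian_density n \<sigma> (\<lambda>i. \<theta> j i + \<theta> l i - \<theta>\<^sub>0 i)" for j l
  define X where "X y = (\<Sum>i\<in>S. (T y i - \<theta>\<^sub>0 i)\<^sup>2)" for y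
  define Y where "Y j y = (\<Sum>i\<in>S. (T y i - \<theta> j i)\<^sup>2)" for j y
  let ?L = "lborel_vec n"
  have [measurable]: "i \<in> S \<Longrightarrow> (\<lambda>y. T y i) \<in> borel_measurable (vec_borel n)" for i
    using S by (intro borel_measurable_component[OF T]) auto
  have [measurable]: "p \<in> borel_measurable (vec_borel n)" "q j \<in> borel_measurable (vec_borel n)"
      "r j l \<in> borel_measurable (vec_borel n)" for j l
    unfolding p_def q_def r_def by measurable
  have [measurable]: "X \<in> borel_measurable (vec_borel n)" "Y j \<in> borel_measurable (vec_borel n)" for j
    unfolding X_def Y_def by measurable
  have pos: "p y > 0" "q j y \<ge> 0" "r j l y \<ge> 0" "X y \<ge> 0" "Y j y \<ge> 0" "G j l \<ge> 0" for j l y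
    unfolding p_def q_def r_def X_def Y_def G_def
    using gaussian_density_pos[OF \<sigma>] gaussian_density_nonneg by (auto intro: sum_nonneg)
  \<comment> \<open>An estimate cannot be close to both vectors: the parallelogram law bounds their
    squared distance by twice the sum of the two losses.\<close>
  have XY: "D - X y \<le> Y j y" if "j < J" for j y
  proof -
    have "(\<theta> j i - \<theta>\<^sub>0 i)\<^sup>2 \<le> 2 * (T y i - \<theta>\<^sub>0 i)\<^sup>2 + 2 * (T y i - \<theta> j i)\<^sup>2" for i
    proof -
      have "2 * (T y i - \<theta>\<^sub>0 i)\<^sup>2 + 2 * (T y i - \<theta> j i)\<^sup>2 - (\<theta> j i - \<theta>\<^sub>0 i)\<^sup>2
        = (2 * T y i - \<theta>\<^sub>0 i - \<theta> j i)\<^sup>2"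
        by (simp add: power2_eq_square algebra_simps)
      then show ?thesis using zero_le_power2[of "2 * T y i - \<theta>\<^sub>0 i - \<theta> j i"] by linarith
    qed
    then have "(\<Sum>i\<in>S. (\<theta> j i - \<theta>\<^sub>0 i)\<^sup>2) \<le> 2 * X y + 2 * Y j y"
      unfolding X_def Y_def sum_distrib_left sum.distrib[symmetric] by (rule sum_mono)
    with sep[OF that] show ?thesis by linarith
  qed
  \<comment> \<open>The pointwise inequality with \<open>J\<close> copies of the null density,
    multiplied by \<open>J\<close> to clear the denominator; the quotient by \<open>p\<close> is
    absorbed by the product formula for Gaussian densities.\<close>
  have point: "D * real J * (\<Sum>j<J. q j y)
      \<le> real J * (real J * (p y * X y) + (\<Sum>j<J. q j y * Y j y))
        + D / 4 * (\<Sum>j<J. \<Sum>l<J. G j l * r j l y)" for y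
  proof -
    have qq: "q j y * q l y = p y * (G j l * r j l y)" for j l
      unfolding q_def p_def r_def G_def
      using gaussian_density_mult[OF \<sigma>, of n "\<theta> j" y "\<theta> l" \<theta>\<^sub>0] by (simp add: mult_ac)
    have "(\<Sum>j<J. q j y) * (D - X y) = (\<Sum>j<J. q j y * (D - X y))"
      by (simp add: sum_distrib_right)
    also have "\<dots> \<le> (\<Sum>j<J. q j y * Y j y)"
      using XY pos by (intro sum_mono mult_left_mono) auto
    finally have le: "(\<Sum>j<J. q j y) * (D - X y) \<le> (\<Sum>j<J. q j y * Y j y)" .
    have "D * (\<Sum>j<J. q j y) \<le> (real J * p y) * X y + (\<Sum>j<J. q j y * Y j y)
        + D * (\<Sum>j<J. q j y)\<^sup>2 / (4 * (real J * p y))"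
      using False pos D le by (intro mixture_loss_pointwise) (auto intro!: sum_nonneg)
    moreover have "(\<Sum>j<J. q j y)\<^sup>2 = p y * (\<Sum>j<J. \<Sum>l<J. G j l * r j l y)"
      unfolding power2_eq_square sum_product qq by (simp add: sum_distrib_left)
    then have "D * (\<Sum>j<J. q j y)\<^sup>2 / (4 * (real J * p y)) = D * (\<Sum>j<J. \<Sum>l<J. G j l * r j l y) / (4 * real J)"
      using pos(1)[of y] by simp
    ultimately have "real J * (D * (\<Sum>j<J. q j y)) \<le> real J * ((real J * p y) * X y + (\<Sum>j<J. q j y * Y j y)
        + D * (\<Sum>j<J. \<Sum>l<J. G j l * r j l y) / (4 * real J))"
      by (intro mult_left_mono) auto
    then show ?thesis using False by (simp add: algebra_simps)
  qed
  have int1: "(\<integral>\<^sup>+ y. ennreal (q j y) \<partial>?L) = 1" "(\<integral>\<^sup>+ y. ennreal (r j l y) \<partial>?L) = 1" for j l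
    unfolding q_def r_def by (rule nn_integral_gaussian_density[OF \<sigma>])+
  define R where "R = of_nat J * block_risk n \<sigma> S T \<theta>\<^sub>0 + (\<Sum>j<J. block_risk n \<sigma> S T (\<theta> j))"
  have m: "(\<lambda>y. ennreal (p y * X y)) \<in> borel_measurable ?L"
      "(\<lambda>y. of_nat J * ennreal (p y * X y)) \<in> borel_measurable ?L"
      "(\<lambda>y. ennreal (q j y * Y j y)) \<in> borel_measurable ?L"
      "(\<lambda>y. \<Sum>j<J. ennreal (q j y * Y j y)) \<in> borel_measurable ?L"
      "(\<lambda>y. ennreal (q j y)) \<in> borel_measurable ?L"
      "(\<lambda>y. \<Sum>j<J. ennreal (q j y)) \<in> borel_measurable ?L" for j
    by measurable
  have R: "(\<integral>\<^sup>+ y. ennreal (real J * (p y * X y) + (\<Sum>j<J. q j y * Y j y)) \<partial>?L) = R"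
  proof -
    have "(\<integral>\<^sup>+ y. ennreal (real J * (p y * X y) + (\<Sum>j<J. q j y * Y j y)) \<partial>?L)
      = (\<integral>\<^sup>+ y. of_nat J * ennreal (p y * X y) + (\<Sum>j<J. ennreal (q j y * Y j y)) \<partial>?L)"
      using pos(1)[THEN less_imp_le] pos(2-)
      by (intro nn_integral_cong) (simp add: ennreal_plus sum_nonneg ennreal_mult ennreal_of_nat_eq_real_of_nat flip: sum_ennreal)
    also have "\<dots> = of_nat J * (\<integral>\<^sup>+ y. ennreal (p y * X y) \<partial>?L) + (\<Sum>j<J. \<integral>\<^sup>+ y. ennreal (q j y * Y j y) \<partial>?L)"
      by (simp only: nn_integral_add nn_integral_cmult nn_integral_sum m)
    also have "\<dots> = R"
      unfolding R_def block_risk_eq[OF \<sigma> T S] p_def q_def X_def Y_def ..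
    finally show ?thesis .
  qed
  have "ennreal (D * (real J)\<^sup>2) = ennreal (D * real J) * (\<Sum>j<J. \<integral>\<^sup>+ y. ennreal (q j y) \<partial>?L)"
    unfolding int1 using D by (simp add: ennreal_mult[symmetric] ennreal_of_nat_eq_real_of_nat power2_eq_square mult.assoc)
  also have "\<dots> = (\<integral>\<^sup>+ y. ennreal (D * real J) * (\<Sum>j<J. ennreal (q j y)) \<partial>?L)"
    by (simp only: nn_integral_cmult nn_integral_sum m)
  also have "\<dots> = (\<integral>\<^sup>+ y. ennreal (D * real J * (\<Sum>j<J. q j y)) \<partial>?L)"
    using D pos by (intro nn_integral_cong) (simp add: ennreal_mult sum_nonneg)
  also have "\<dots> \<le> (\<integral>\<^sup>+ y. ennreal (real J * (real J * (p y * X y) + (\<Sum>j<J. q j y * Y j y))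
        + D / 4 * (\<Sum>j<J. \<Sum>l<J. G j l * r j l y)) \<partial>?L)"
    by (intro nn_integral_mono ennreal_leI point)
  also have "\<dots> = (\<integral>\<^sup>+ y. of_nat J * ennreal (real J * (p y * X y) + (\<Sum>j<J. q j y * Y j y))
        + ennreal (D / 4) * (\<Sum>j<J. \<Sum>l<J. ennreal (G j l) * ennreal (r j l y)) \<partial>?L)"
  proof (rule nn_integral_cong)
    fix y
    have "0 \<le> real J * (p y * X y) + (\<Sum>j<J. q j y * Y j y)"
      using pos(1)[THEN less_imp_le] pos by (intro add_nonneg_nonneg sum_nonneg mult_nonneg_nonneg) auto
    moreover have "0 \<le> (\<Sum>j<J. \<Sum>l<J. G j l * r j l y)"
      using pos by (intro sum_nonneg mult_nonneg_nonneg) auto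
    moreover have "ennreal (\<Sum>j<J. \<Sum>l<J. G j l * r j l y)
        = (\<Sum>j<J. \<Sum>l<J. ennreal (G j l) * ennreal (r j l y))"
      using pos by (simp add: sum_nonneg flip: ennreal_mult)
    ultimately show "ennreal (real J * (real J * (p y * X y) + (\<Sum>j<J. q j y * Y j y))
        + D / 4 * (\<Sum>j<J. \<Sum>l<J. G j l * r j l y))
      = of_nat J * ennreal (real J * (p y * X y) + (\<Sum>j<J. q j y * Y j y))
        + ennreal (D / 4) * (\<Sum>j<J. \<Sum>l<J. ennreal (G j l) * ennreal (r j l y))"
      using D by (simp only: ennreal_plus ennreal_mult ennreal_of_nat_eq_real_of_nat
          mult_nonneg_nonneg of_nat_0_le_iff divide_nonneg_nonneg zero_le_numeral)
  qed
  also have "\<dots> = of_nat J * R + ennreal (D / 4) * (\<Sum>j<J. \<Sum>l<J. ennreal (G j l))"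
  proof -
    have m': "(\<lambda>y. ennreal (r j l y)) \<in> borel_measurable ?L"
        "(\<lambda>y. ennreal (G j l) * ennreal (r j l y)) \<in> borel_measurable ?L"
        "(\<lambda>y. \<Sum>l<J. ennreal (G j l) * ennreal (r j l y)) \<in> borel_measurable ?L"
        "(\<lambda>y. \<Sum>j<J. \<Sum>l<J. ennreal (G j l) * ennreal (r j l y)) \<in> borel_measurable ?L"
        "(\<lambda>y. ennreal (D / 4) * (\<Sum>j<J. \<Sum>l<J. ennreal (G j l) * ennreal (r j l y)))
          \<in> borel_measurable ?L"
        "(\<lambda>y. ennreal (real J * (p y * X y) + (\<Sum>j<J. q j y * Y j y))) \<in> borel_measurable ?L"
        "(\<lambda>y. of_nat J * ennreal (real J * (p y * X y) + (\<Sum>j<J. q j y * Y j y))) \<in> borel_measurable ?L"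
      for j l by measurable
    show ?thesis
      by (simp only: nn_integral_add nn_integral_cmult nn_integral_sum m' int1 R mult_1_right)
  qed
  also have "(\<Sum>j<J. \<Sum>l<J. ennreal (G j l)) = ennreal (\<Sum>j<J. \<Sum>l<J. G j l)"
    using pos by (simp add: sum_nonneg)
  also have "\<dots> \<le> ennreal (13 / 4 * (real J)\<^sup>2)"
    using gram unfolding G_def by (rule ennreal_leI)
  finally have main: "ennreal (D * (real J)\<^sup>2) \<le> of_nat J * R + ennreal (D / 4) * ennreal (13 / 4 * (real J)\<^sup>2)"
    by (simp add: add_left_mono mult_left_mono)
  show ?thesis
    unfolding R_def[symmetric]
  proof (cases R)
    case (real R')
    have "ennreal (D * (real J)\<^sup>2) \<le> ennreal (real J * R' + D / 4 * (13 / 4 * (real J)\<^sup>2))"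
      using main D real by (simp add: ennreal_of_nat_eq_real_of_nat flip: ennreal_mult ennreal_plus)
    then have "D * (real J)\<^sup>2 \<le> real J * R' + D / 4 * (13 / 4 * (real J)\<^sup>2)"
      using D real by (subst (asm) ennreal_le_iff) auto
    \<comment> \<open>The factor is 1 - 13/16, where 13/16 is a quarter of the Gram bound; any Gram
      constant below 4 would leave a positive remainder.\<close>
    then have "real J * (3 / 16 * D * real J) \<le> real J * R'"
      by (simp add: power2_eq_square algebra_simps)
    then have "3 / 16 * D * real J \<le> R'"
      using False by simp
    then show "ennreal (3 / 16 * D * real J) \<le> R"
      using real by (simp add: ennreal_leI)
  qed simp
qed simp

subsection \<open>Convex piecewise linear perturbations\<close>


definition hat :: "real \<Rightarrow> real \<Rightarrow> real \<Rightarrow> real" where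
  "hat h w t = h * max 0 (1 - \<bar>t\<bar> / w)"

lemma hat_outside: "0 < w \<Longrightarrow> w \<le> \<bar>t\<bar> \<Longrightarrow> hat h w t = 0"
  by (simp add: hat_def max_def)

lemma hat_inside: "0 < w \<Longrightarrow> \<bar>t\<bar> \<le> w \<Longrightarrow> hat h w t = h - h / w * \<bar>t\<bar>"
  by (simp add: hat_def max_def right_diff_distrib)

lemma convex_on_max:
  fixes f g :: "'a::real_vector \<Rightarrow> real"
  assumes f: "convex_on S f" and g: "convex_on S g"
  shows "convex_on S (\<lambda>x. max (f x) (g x))"
proof (rule convex_onI)
  fix t :: real and x y assume *: "0 < t" "t < 1" "x \<in> S" "y \<in> S"
  let ?M = "(1 - t) * max (f x) (g x) + t * max (f y) (g y)"
  have "f ((1 - t) *\<^sub>R x + t *\<^sub>R y) \<le> (1 - t) * f x + t * f y"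
    using * by (intro convex_onD[OF f]) auto
  also have "\<dots> \<le> ?M"
    using * by (intro add_mono mult_left_mono) auto
  finally have "f ((1 - t) *\<^sub>R x + t *\<^sub>R y) \<le> ?M" .
  moreover have "g ((1 - t) *\<^sub>R x + t *\<^sub>R y) \<le> (1 - t) * g x + t * g y"
    using * by (intro convex_onD[OF g]) auto
  then have "g ((1 - t) *\<^sub>R x + t *\<^sub>R y) \<le> ?M"
    by (rule order_trans) (use * in \<open>intro add_mono mult_left_mono; auto\<close>)
  ultimately show "max (f ((1 - t) *\<^sub>R x + t *\<^sub>R y)) (g ((1 - t) *\<^sub>R x + t *\<^sub>R y)) \<le> ?M"
    by simp
qed (use f in \<open>simp add: convex_on_def\<close>)

text \<open>The hat has a concave kink at 0, which the steep absolute value compensates.\<close>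

lemma convex_on_abs_plus_hat:
  assumes "0 < w" "0 \<le> h" "h \<le> A * w"
  shows "convex_on UNIV (\<lambda>x. A * \<bar>x - c\<bar> + hat h w (x - c))"
proof -
  have A: "A \<ge> 0" using assms by (auto simp: zero_le_mult_iff dest: order_trans)
  have B: "A - h / w \<ge> 0" using assms by (simp add: field_simps)
  have abs: "convex_on UNIV (\<lambda>x. \<bar>x - c\<bar>)"
    using convex_on_dist[of UNIV c] by (simp add: dist_real_def abs_minus_commute)
  have 1: "convex_on UNIV (\<lambda>x. A * \<bar>x - c\<bar>)"
    using convex_on_cmul[OF A abs] .
  have 2: "convex_on UNIV (\<lambda>x. (A - h / w) * \<bar>x - c\<bar> + h)"
    using convex_on_cmul[OF B abs] by (intro convex_on_add) (auto simp: convex_on_const)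
  \<comment> \<open>Adding the hat takes the maximum of the old cone and a flatter, raised one; the
    flatter cone has slope \<open>A - h / w \<ge> 0\<close>, so both are convex.\<close>
  have eq: "A * \<bar>x - c\<bar> + hat h w (x - c) = max (A * \<bar>x - c\<bar>) ((A - h / w) * \<bar>x - c\<bar> + h)" for x
  proof -
    have "h * max 0 (1 - \<bar>x - c\<bar> / w) = max 0 (h - h / w * \<bar>x - c\<bar>)"
      using assms by (simp add: max_mult_distrib_left algebra_simps)
    then show ?thesis unfolding hat_def by (simp add: max_def algebra_simps)
  qed
  show ?thesis unfolding eq by (rule convex_on_max[OF 1 2])
qed

lemma convex_on_sum_fun:
  assumes "finite I" "convex S" "\<And>i. i \<in> I \<Longrightarrow> convex_on S (f i)"
  shows "convex_on S (\<lambda>x. \<Sum>i\<in>I. f i x)"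
  using assms(1,3)
proof (induction I rule: finite_induct)
  case empty
  then show ?case using assms(2) by (simp add: convex_on_const)
next
  case (insert i I)
  then show ?case using convex_on_add[of S "f i" "\<lambda>x. \<Sum>i\<in>I. f i x"] by simp
qed

text \<open>Chord slopes of a convex function increase in each endpoint, so the chord over [x, v]
  can be moved to that over [y, t]. Midpoints serve as left ends because the pieces are open on the
  left.\<close>

lemma slopes_nondecreasing_of_convex:
  assumes F: "convex_on {0..1} f"
  shows "slopes_nondecreasing f"
  unfolding slopes_nondecreasing_def
proof (intro allI impI, elim conjE)
  fix u v s t b b' :: real
  assume *: "0 \<le> u" "u < v" "v \<le> s" "s < t" "t \<le> 1"
    and "affine_with_slope f b {u<..v}" "affine_with_slope f b' {s<..t}"
  then obtain a a' where a: "\<And>x. x \<in> {u<..v} \<Longrightarrow> f x = a + b * x"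
    and a': "\<And>x. x \<in> {s<..t} \<Longrightarrow> f x = a' + b' * x"
    unfolding affine_with_slope_def by blast
  define x where "x = (u + v) / 2"
  define y where "y = (s + t) / 2"
  have xy: "u < x" "x < v" "v < y" "s < y" "y < t" using * by (auto simp: x_def y_def)
  have "(f x - f v) / (x - v) \<le> (f x - f y) / (x - y)"
    using xy * by (intro convex_on_slope_le(1)[OF F]) auto
  also have "\<dots> \<le> (f x - f t) / (x - t)"
    using xy * by (intro convex_on_slope_le(1)[OF F]) auto
  also have "\<dots> \<le> (f y - f t) / (y - t)"
    using xy * by (intro convex_on_slope_le(2)[OF F]) auto
  finally show "b \<le> b'"
    using xy * by (simp add: a a' right_diff_distrib[symmetric])
qed

section \<open>Piecewise affinity in the grid coordinate n * x\<close>

definition affine_between :: "(real \<Rightarrow> real) \<Rightarrow> real \<Rightarrow> real \<Rightarrow> bool" where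
  "affine_between f l u \<longleftrightarrow> (\<exists>a b. \<forall>x\<in>{l..u}. f x = a + b * x)"

lemma affine_betweenI:
  "(\<And>x. l \<le> x \<Longrightarrow> x \<le> u \<Longrightarrow> f x = a + b * x) \<Longrightarrow> affine_between f l u"
  unfolding affine_between_def by auto

lemma affine_between_sum:
  assumes "finite I" "\<And>i. i \<in> I \<Longrightarrow> affine_between (f i) l u"
  shows "affine_between (\<lambda>x. \<Sum>i\<in>I. f i x) l u"
  using assms
proof (induction I rule: finite_induct)
  case empty
  then show ?case by (intro affine_betweenI[of l u _ 0 0]) simp
next
  case (insert i I)
  then obtain a b a' b' where "\<And>x. x \<in> {l..u} \<Longrightarrow> f i x = a + b * x"
      "\<And>x. x \<in> {l..u} \<Longrightarrow> (\<Sum>i\<in>I. f i x) = a' + b' * x"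
    unfolding affine_between_def by (meson insertI1 insertI2)
  then show ?case using insert
    by (intro affine_betweenI[of l u _ "a + a'" "b + b'"]) (simp add: algebra_simps)
qed

text \<open>The three disjunctions keep the kinks out of the open interval, so a nonempty [l, u]
  falls into one of four linear zones.\<close>

lemma affine_between_abs_plus_hat:
  assumes "0 < w" "c \<le> l \<or> u \<le> c" "c - w \<le> l \<or> u \<le> c - w" "c + w \<le> l \<or> u \<le> c + w"
  shows "affine_between (\<lambda>x. A * \<bar>x - c\<bar> + hat h w (x - c)) l u"
proof (cases "u < l")
  case False
  consider "c + w \<le> l" | "c \<le> l" "u \<le> c + w" | "u \<le> c" "c - w \<le> l" | "u \<le> c - w"
    using assms False by linarith
  then show ?thesis
  proof cases
    case 1
    then show ?thesis using assms
      by (intro affine_betweenI[of l u _ "- A * c" A]) (simp add: hat_outside algebra_simps)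
  next
    case 2
    then show ?thesis using assms
      by (intro affine_betweenI[of l u _ "- A * c + h + h / w * c" "A - h / w"])
        (simp add: hat_inside algebra_simps diff_divide_distrib)
  next
    case 3
    then show ?thesis using assms
      by (intro affine_betweenI[of l u _ "A * c + h - h / w * c" "- A + h / w"])
        (simp add: hat_inside abs_of_nonpos algebra_simps diff_divide_distrib)
  next
    case 4
    then show ?thesis using assms
      by (intro affine_betweenI[of l u _ "A * c" "- A"]) (simp add: hat_outside abs_of_nonpos algebra_simps)
  qed
qed (simp add: affine_between_def)

text \<open>The last centre is the right endpoint \<open>n\<close>, where only half a hat is visible; this
  is what makes two pieces suffice for one block.\<close>

definition block_centre :: "nat \<Rightarrow> nat \<Rightarrow> nat \<Rightarrow> nat \<Rightarrow> nat" where
  "block_centre n m B b = n - 2 * m * (B - 1 - b)"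

lemma block_centre_bounds:
  assumes "2 * m * B \<le> n" "b < B"
  shows "2 * m \<le> block_centre n m B b" "block_centre n m B b \<le> n"
proof -
  obtain e where e: "B = b + 1 + e" using assms(2) by (auto simp: less_iff_Suc_add)
  have "2 * m * (B - 1 - b) + 2 * m \<le> n"
    using assms(1) unfolding e by (simp add: algebra_simps)
  then show "2 * m \<le> block_centre n m B b" "block_centre n m B b \<le> n"
    unfolding block_centre_def by linarith+
qed

lemma block_centre_last: "block_centre n m B (B - 1) = n"
  by (simp add: block_centre_def)

lemma block_centre_add:
  assumes "2 * m * B \<le> n" "b + d < B"
  shows "block_centre n m B (b + d) = block_centre n m B b + 2 * m * d"
proof -
  obtain e where e: "B = b + d + 1 + e" using assms(2) by (auto simp: less_iff_Suc_add)
  show ?thesis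
    using assms(1) unfolding e block_centre_def by (simp add: algebra_simps)
qed

text \<open>The indices 3b+1, 3b+2, 3b+3 carry left foot, centre and right foot of hat
  \<open>b\<close>. From index 3B-1, the last centre, the value stays at \<open>n\<close>, so that
  any surplus of \<open>k\<close> is filled with empty pieces.\<close>

definition knot :: "nat \<Rightarrow> nat \<Rightarrow> nat \<Rightarrow> (nat \<Rightarrow> nat) \<Rightarrow> nat \<Rightarrow> nat" where
  "knot n m B w i = (if i = 0 then 0 else if 3 * B \<le> i + 1 then n
    else let b = (i - 1) div 3; c = block_centre n m B b in
      if (i - 1) mod 3 = 0 then c - w b else if (i - 1) mod 3 = 1 then c else c + w b)"

lemma knot_simps:
  shows "knot n m B w 0 = 0"
    and "3 * B \<le> i + 1 \<Longrightarrow> 0 < B \<Longrightarrow> knot n m B w i = n"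
    and "b < B \<Longrightarrow> knot n m B w (3 * b + 1) = block_centre n m B b - w b"
    and "b < B \<Longrightarrow> knot n m B w (3 * b + 2) = block_centre n m B b"
    and "b + 1 < B \<Longrightarrow> knot n m B w (3 * b + 3) = block_centre n m B b + w b"
proof -
  show "knot n m B w 0 = 0" by (simp add: knot_def)
  show "3 * B \<le> i + 1 \<Longrightarrow> 0 < B \<Longrightarrow> knot n m B w i = n" by (auto simp: knot_def)
  show "knot n m B w (3 * b + 1) = block_centre n m B b - w b" if "b < B"
    using that by (simp add: knot_def)
  show "knot n m B w (3 * b + 2) = block_centre n m B b" if "b < B"
  proof (cases "b = B - 1")
    case True
    then have "B = Suc b" using that by simp
    then show ?thesis by (simp add: knot_def block_centre_def)
  next
    case False
    have "(3 * b + 1) div 3 = b" "(3 * b + 1) mod 3 = 1" by presburger+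
    moreover have "b + 1 < B" using that False by simp
    ultimately show ?thesis by (simp add: knot_def)
  qed
  have "(3 * b + 2) div 3 = b" "(3 * b + 2) mod 3 = 2" by presburger+
  then show "b + 1 < B \<Longrightarrow> knot n m B w (3 * b + 3) = block_centre n m B b + w b"
    by (simp add: knot_def)
qed

text \<open>Within a hat the gap is its width, at least 2. Between neighbouring hats it is 2m minus
  two widths of at most m-1, again at least 2.\<close>

lemma knot_step:
  assumes B: "0 < B" and n: "2 * m * B \<le> n" and w: "\<And>b. b < B \<Longrightarrow> 2 \<le> w b \<and> w b < m"
  shows "knot n m B w i = knot n m B w (Suc i) \<or> knot n m B w i + 2 \<le> knot n m B w (Suc i)"
proof (cases "3 * B \<le> i + 1")
  case True
  then show ?thesis using B by (simp add: knot_simps(2))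
next
  case False
  define b where "b = i div 3"
  consider "i = 0" | "i = 3 * b + 1" | "i = 3 * b + 2" | b' where "i = 3 * b' + 3"
  proof -
    have "i = 3 * b \<or> i = 3 * b + 1 \<or> i = 3 * b + 2" unfolding b_def by presburger
    then show ?thesis using that by (cases b) auto
  qed
  then show ?thesis
  proof cases
    case 1
    then show ?thesis
      using knot_simps(3)[OF B, of n m w] block_centre_bounds(1)[OF n B] w[OF B]
      by (simp add: knot_simps(1)) linarith
  next
    case 2
    then have "b < B" using False by simp
    then show ?thesis
      using 2 w[of b] block_centre_bounds(1)[OF n, of b] knot_simps(3,4)[of b B n m w] by simp linarith
  next
    case 3
    then have "b + 1 < B" using False by simp
    then show ?thesis
      using 3 w[of b] knot_simps(4,5)[of b B n m w] by (simp add: numeral_3_eq_3)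
  next
    case (4 b')
    then have b': "b' + 1 < B" using False by simp
    then show ?thesis
      using 4 w[of b'] w[of "b' + 1"] block_centre_add[OF n b'] knot_simps(5)[of b' B n m w]
        knot_simps(3)[of "b' + 1" B n m w] by (simp add: numeral_3_eq_3) linarith
  qed
qed

text \<open>All kinks inside the range are knots, and every summand is convex and continuous, so
  convexity gives the slope order and continuity gives the matching limits. The function is built on
  the grid scale and then rescaled to the unit interval.\<close>

lemma sum_abs_plus_hat_in_Theta_star:
  fixes h :: "nat \<Rightarrow> real" and w :: "nat \<Rightarrow> nat"
  assumes B: "0 < B" and n: "2 * m * B \<le> n" and k: "3 * B \<le> k + 1"
    and w: "\<And>b. b < B \<Longrightarrow> 2 \<le> w b \<and> w b < m"
    and h: "\<And>b. b < B \<Longrightarrow> 0 \<le> h b \<and> h b \<le> A * real (w b)"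
  shows "(\<lambda>i\<in>{1..n}. \<Sum>b<B. A * \<bar>real i - block_centre n m B b\<bar>
    + hat (h b) (w b) (real i - block_centre n m B b)) \<in> Theta_star n k"
proof -
  define F where "F x = (\<Sum>b<B. A * \<bar>x - block_centre n m B b\<bar>
    + hat (h b) (w b) (x - block_centre n m B b))" for x :: real
  define f where "f = (\<lambda>x\<in>{0..1}. F (real n * x))"
  define \<nu> where "\<nu> = knot n m B w"
  have n0: "n > 0" using block_centre_bounds[OF n B] w[OF B] by linarith
  have step: "\<nu> i = \<nu> (Suc i) \<or> \<nu> i + 2 \<le> \<nu> (Suc i)" for i
    unfolding \<nu>_def by (rule knot_step[OF B n w])
  have mono: "\<nu> i \<le> \<nu> j" if "i \<le> j" for i j
  proof (rule lift_Suc_mono_le[OF _ that])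
    show "\<nu> i \<le> \<nu> (Suc i)" for i using step[of i] by auto
  qed
  have \<nu>k: "\<nu> k = n"
    unfolding \<nu>_def using k B by (simp add: knot_simps(2))
  have \<nu>n: "\<nu> i \<le> n" for i
    using mono[of i "max i (3 * B)"] B unfolding \<nu>_def by (simp add: knot_simps(2))
  \<comment> \<open>By monotonicity no knot lies strictly inside a piece, which is the form in which
    affinity of a summand asks for its kinks.\<close>
  have knot_outside: "real (\<nu> j) \<le> real (\<nu> i) \<or> real (\<nu> (Suc i)) \<le> real (\<nu> j)" for i j
    using mono[of j i] mono[of "Suc i" j] by (cases "j \<le> i") auto
  have affine: "affine_between F (real (\<nu> i)) (real (\<nu> (Suc i)))" for i
    unfolding F_def
  proof (intro affine_between_sum affine_between_abs_plus_hat finite_lessThan)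
    fix b assume "b \<in> {..<B}"
    then have b: "b < B" by simp
    note wb = w[OF b] and cb = block_centre_bounds[OF n b]
    show "0 < real (w b)" using wb by simp
    have 1: "real (block_centre n m B b) = real (\<nu> (3 * b + 2))"
      unfolding \<nu>_def using knot_simps(4)[OF b] by simp
    have 2: "real (block_centre n m B b) - real (w b) = real (\<nu> (3 * b + 1))"
      unfolding \<nu>_def using knot_simps(3)[OF b] wb cb by simp
    show "real (block_centre n m B b) \<le> real (\<nu> i) \<or> real (\<nu> (Suc i)) \<le> real (block_centre n m B b)"
      unfolding 1 by (rule knot_outside)
    show "real (block_centre n m B b) - real (w b) \<le> real (\<nu> i)
      \<or> real (\<nu> (Suc i)) \<le> real (block_centre n m B b) - real (w b)"
      unfolding 2 by (rule knot_outside)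
    show "real (block_centre n m B b) + real (w b) \<le> real (\<nu> i)
      \<or> real (\<nu> (Suc i)) \<le> real (block_centre n m B b) + real (w b)"
    proof (cases "b + 1 < B")
      case True
      have 3: "real (block_centre n m B b) + real (w b) = real (\<nu> (3 * b + 3))"
        unfolding \<nu>_def using knot_simps(5)[OF True] by simp
      show ?thesis unfolding 3 by (rule knot_outside)
    next
      \<comment> \<open>The right foot of the last hat is not a knot; it lies beyond
        \<open>n\<close> and therefore to the right of every piece.\<close>
      case False
      then have "b = B - 1" using b by linarith
      then have "block_centre n m B b = n" by (simp only: block_centre_last)
      then show ?thesis using \<nu>n[of "Suc i"] by simp
    qed
  qed
  have cont: "continuous_on UNIV (\<lambda>x. F (real n * x))"
  proof -
    have "real (w b) \<noteq> 0" if "b \<in> {..<B}" for b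
      using w[of b] that by simp
    then show ?thesis
      unfolding F_def hat_def by (intro continuous_intros) auto
  qed
  have conv: "convex_on UNIV F"
    unfolding F_def[abs_def]
  proof (rule convex_on_sum_fun)
    fix b assume "b \<in> {..<B}"
    then have "b < B" by simp
    then show "convex_on UNIV (\<lambda>x. A * \<bar>x - block_centre n m B b\<bar> + hat (h b) (w b) (x - block_centre n m B b))"
      using w[of b] h[of b] by (intro convex_on_abs_plus_hat) auto
  qed auto
  have "convex_on {0..1} f"
  proof (rule convex_onI)
    fix t x y :: real assume *: "0 < t" "t < 1" "x \<in> {0..1}" "y \<in> {0..1}"
    then have "(1 - t) *\<^sub>R x + t *\<^sub>R y \<in> {0..1}"
      using convex_real_interval(5)[of 0 "1::real"] by (auto simp: convex_alt)
    moreover have "F (real n * ((1 - t) *\<^sub>R x + t *\<^sub>R y))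
        \<le> (1 - t) * F (real n * x) + t * F (real n * y)"
      using convex_onD[OF conv, of t "real n * x" "real n * y"] * by (simp add: algebra_simps)
    ultimately show "f ((1 - t) *\<^sub>R x + t *\<^sub>R y) \<le> (1 - t) * f x + t * f y"
      using * by (simp add: f_def)
  qed simp
  then have "slopes_nondecreasing f" by (rule slopes_nondecreasing_of_convex)
  moreover have "f \<in> pw_linear_class n k"
    unfolding pw_linear_class_def mem_Collect_eq
  proof (intro CollectI conjI exI[of _ \<nu>] ballI impI)
    show "f \<in> extensional {0..1}" by (simp add: f_def)
    show "\<nu> 0 = 0" by (simp add: \<nu>_def knot_simps)
    show "\<nu> k = n" by fact
  next
    fix i assume "i \<in> {1..k}"
    then obtain j where i: "i = Suc j" by (cases i) auto
    show "\<nu> (i - 1) \<le> \<nu> i" using mono by simp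
    show "2 \<le> \<nu> i - \<nu> (i - 1)" if "\<nu> (i - 1) < \<nu> i" using step[of j] that i by auto
    obtain a b where ab: "\<And>x. x \<in> {real (\<nu> j)..real (\<nu> (Suc j))} \<Longrightarrow> F x = a + b * x"
      using affine[of j] unfolding affine_between_def by blast
    have "affine_with_slope f (b * n) {real (\<nu> (i - 1)) / real n<..real (\<nu> i) / real n}"
      unfolding affine_with_slope_def
    proof (intro exI[of _ a] ballI)
      fix x assume x: "x \<in> {real (\<nu> (i - 1)) / real n<..real (\<nu> i) / real n}"
      then have "real (\<nu> (i - 1)) < real n * x" "real n * x \<le> real (\<nu> i)"
        using n0 by (auto simp: field_simps)
      moreover have "0 \<le> x"
        using x divide_nonneg_nonneg[of "real (\<nu> (i - 1))" "real n"] by (simp only: greaterThanAtMost_iff) linarith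
      moreover have "real (\<nu> i) / real n \<le> 1"
        using n0 \<nu>n[of i] by simp
      then have "x \<le> 1"
        using x by simp
      ultimately show "f x = a + b * real n * x"
        using ab[of "real n * x"] i by (simp add: f_def)
    qed
    then show "\<exists>b. affine_with_slope f b {real (\<nu> (i - 1)) / real n<..real (\<nu> i) / real n}" ..
  next
    fix i assume "0 < \<nu> i \<and> \<nu> i < n"
    then have x: "real (\<nu> i) / real n \<in> {0<..<1}" by simp
    let ?x = "real (\<nu> i) / real n"
    \<comment> \<open>The knot is interior to the unit interval, so the restriction of
      \<open>f\<close> is invisible nearby and its one-sided limits are those of the continuous
      rescaled \<open>F\<close>.\<close>
    have ev: "eventually (\<lambda>y. F (real n * y) = f y) (nhds ?x)"
    proof (rule eventually_mono)
      show "eventually (\<lambda>y. y \<in> {0<..<1}) (nhds ?x)"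
        using x by (intro eventually_nhds_in_open) auto
    qed (simp add: f_def)
    have "((\<lambda>y. F (real n * y)) \<longlongrightarrow> F (real n * ?x)) (nhds ?x)"
    proof (rule tendsto_at_iff_tendsto_nhds[THEN iffD1, of "\<lambda>y. F (real n * y)" ?x])
      show "((\<lambda>y. F (real n * y)) \<longlongrightarrow> F (real n * ?x)) (at ?x)"
        using cont continuous_on_eq_continuous_at[OF open_UNIV] isContD by blast
    qed
    then have "(f \<longlongrightarrow> F (real n * ?x)) (nhds ?x)"
      using ev by (rule Lim_transform_eventually)
    then have "(f \<longlongrightarrow> F (real n * ?x)) (at ?x within S)" for S
      by (rule tendsto_mono[rotated]) (simp add: at_within_def)
    then show "\<exists>l. (f \<longlongrightarrow> l) (at_left ?x) \<and> (f \<longlongrightarrow> l) (at_right ?x)" by blast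
  qed
  ultimately have "f \<in> convex_pw_linear_class n k"
    by (simp add: convex_pw_linear_class_def)
  then show ?thesis
    unfolding Theta_star_def using n0
    by (auto intro!: bexI[of _ f] simp: f_def F_def)
qed

subsection \<open>Hats at separated scales\<close>


lemma sum_squares_ge: "real w ^ 3 / 3 \<le> (\<Sum>s=1..w. (real s)\<^sup>2)"
proof (induction w)
  case (Suc w)
  have "real (Suc w) ^ 3 / 3 \<le> real w ^ 3 / 3 + (real (Suc w))\<^sup>2"
    by (simp add: power2_eq_square power3_eq_cube algebra_simps)
  then show ?case using Suc by simp
qed simp

text \<open>Only the left flank is counted, since this is all that the hat at the right endpoint
  shows; on it the values are h * s / w for s = 1, ..., w.\<close>

lemma hat_energy:
  fixes c w :: nat
  assumes "0 < w" "w \<le> c" "finite S" "{c - w<..c} \<subseteq> S"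
  shows "h\<^sup>2 * real w / 3 \<le> (\<Sum>i\<in>S. (hat h w (real i - real c))\<^sup>2)"
proof -
  have "h\<^sup>2 * real w / 3 = h\<^sup>2 / (real w)\<^sup>2 * (real w ^ 3 / 3)"
    using assms(1) by (simp add: power2_eq_square power3_eq_cube)
  also have "\<dots> \<le> h\<^sup>2 / (real w)\<^sup>2 * (\<Sum>s=1..w. (real s)\<^sup>2)"
    by (intro mult_left_mono sum_squares_ge) auto
  also have "\<dots> = (\<Sum>s=1..w. (hat h w (real (c - w + s) - real c))\<^sup>2)"
    unfolding sum_distrib_left
  proof (rule sum.cong[OF refl])
    fix s assume s: "s \<in> {1..w}"
    have "real (c - w + s) - real c = - (real w - real s)"
      using assms(2) by simp
    then have "\<bar>real (c - w + s) - real c\<bar> = real w - real s"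
      using s by simp
    then have "hat h w (real (c - w + s) - real c) = h * (real s / real w)"
      unfolding hat_def by (simp only:) (use assms(1) s in \<open>simp add: max_def field_simps\<close>)
    then show "h\<^sup>2 / (real w)\<^sup>2 * (real s)\<^sup>2 = (hat h w (real (c - w + s) - real c))\<^sup>2"
      by (simp add: power_mult_distrib power_divide)
  qed
  also have "\<dots> = (\<Sum>i\<in>(\<lambda>s. c - w + s) ` {1..w}. (hat h w (real i - real c))\<^sup>2)"
    by (subst sum.reindex) (auto simp: inj_on_def)
  also have "\<dots> \<le> (\<Sum>i\<in>S. (hat h w (real i - real c))\<^sup>2)"
  proof (rule sum_mono2[OF assms(3)])
    have "(\<lambda>s. c - w + s) ` {1..w} \<subseteq> {c - w<..c}" using assms(2) by auto
    then show "(\<lambda>s. c - w + s) ` {1..w} \<subseteq> S" using assms(4) by blast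
  qed auto
  finally show ?thesis .
qed

lemma hat_nonneg: "0 \<le> h \<Longrightarrow> 0 \<le> hat h w t"
  by (simp add: hat_def)

lemma hat_le: "0 \<le> h \<Longrightarrow> 0 \<le> w \<Longrightarrow> hat h w t \<le> h"
  by (simp add: hat_def mult_left_le)

text \<open>The product lives on fewer than \<open>2 * min w w'\<close> indices around the centre
  and is at most \<open>h * h'\<close> there.\<close>

lemma hat_inner_le:
  fixes c w w' :: nat
  assumes h: "0 \<le> h" "0 \<le> h'" and w: "0 < w" "0 < w'" and S: "finite S"
  shows "(\<Sum>i\<in>S. hat h w (real i - real c) * hat h' w' (real i - real c)) \<le> 2 * real (min w w') * (h * h')"
proof -
  define v where "v = min w w'"
  define I where "I = {c + 1 - v..<c + v}"
  have "(\<Sum>i\<in>S. hat h w (real i - real c) * hat h' w' (real i - real c))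
      \<le> (\<Sum>i\<in>S. if i \<in> I then h * h' else 0)"
  proof (rule sum_mono)
    fix i
    show "hat h w (real i - real c) * hat h' w' (real i - real c) \<le> (if i \<in> I then h * h' else 0)"
    proof (cases "i \<in> I")
      case True
      then show ?thesis using h w by (auto intro!: mult_mono hat_le hat_nonneg)
    next
      case False
      then have "c + 1 - v > i \<or> i \<ge> c + v" by (auto simp: I_def)
      then have "real v \<le> \<bar>real i - real c\<bar>" by linarith
      then have "real w \<le> \<bar>real i - real c\<bar> \<or> real w' \<le> \<bar>real i - real c\<bar>"
        unfolding v_def by linarith
      then have "hat h w (real i - real c) = 0 \<or> hat h' w' (real i - real c) = 0"
        using w by (auto intro: hat_outside)
      then show ?thesis using False by auto
    qed
  qed
  also have "\<dots> = real (card (S \<inter> I)) * (h * h')"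
    using S by (simp add: sum.If_cases)
  also have "card (S \<inter> I) \<le> card I"
    by (intro card_mono) (auto simp: I_def)
  then have "real (card (S \<inter> I)) * (h * h') \<le> 2 * real v * (h * h')"
    using h by (intro mult_right_mono) (auto simp: I_def)
  finally show ?thesis by (simp add: v_def)
qed

section \<open>Averaging over a uniform product prior\<close>

text \<open>Bayes risk below minimax risk, as a double count over all configurations: for each
  \<open>b\<close> they split into fibres in which only coordinate \<open>b\<close> varies, and each
  fibre contributes at least \<open>s\<close>. Working with sums in \<open>ennreal\<close> also
  covers infinite risks.\<close>

lemma prior_average_le:
  fixes r :: "'b \<Rightarrow> ('b \<Rightarrow> 'x) \<Rightarrow> ennreal" and s R :: ennreal
  assumes I: "finite I" and X: "finite X" "X \<noteq> {}"
    and s: "\<And>b g. b \<in> I \<Longrightarrow> g \<in> (I - {b}) \<rightarrow>\<^sub>E X \<Longrightarrow> s \<le> (\<Sum>x\<in>X. r b (g(b := x)))"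
    and R: "\<And>g. g \<in> I \<rightarrow>\<^sub>E X \<Longrightarrow> (\<Sum>b\<in>I. r b g) \<le> R"
  shows "of_nat (card I) * s \<le> of_nat (card X) * R"
proof (cases "I = {}")
  case False
  define N where "N = card X ^ (card I - 1)"
  have "of_nat N * s \<le> (\<Sum>g\<in>I \<rightarrow>\<^sub>E X. r b g)" if b: "b \<in> I" for b
  proof -
    have "of_nat N * s = (\<Sum>g\<in>(I - {b}) \<rightarrow>\<^sub>E X. s)"
      using I b by (simp add: card_funcsetE N_def)
    also have "\<dots> \<le> (\<Sum>g\<in>(I - {b}) \<rightarrow>\<^sub>E X. \<Sum>x\<in>X. r b (g(b := x)))"
      by (intro sum_mono s b)
    also have "\<dots> = (\<Sum>(x, g)\<in>X \<times> ((I - {b}) \<rightarrow>\<^sub>E X). r b (g(b := x)))"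
      by (subst sum.swap) (simp add: sum.cartesian_product)
    also have "\<dots> = (\<Sum>g\<in>(\<lambda>(x, g). g(b := x)) ` (X \<times> ((I - {b}) \<rightarrow>\<^sub>E X)). r b g)"
      by (subst sum.reindex) (auto intro!: inj_combinator sum.cong)
    also have "(\<lambda>(x, g). g(b := x)) ` (X \<times> ((I - {b}) \<rightarrow>\<^sub>E X)) = I \<rightarrow>\<^sub>E X"
      using PiE_insert_eq[of b "I - {b}" "\<lambda>_. X"] b by (simp add: insert_absorb)
    finally show ?thesis .
  qed
  then have "(\<Sum>b\<in>I. of_nat N * s) \<le> (\<Sum>b\<in>I. \<Sum>g\<in>I \<rightarrow>\<^sub>E X. r b g)"
    by (rule sum_mono)
  also have "\<dots> \<le> (\<Sum>g\<in>I \<rightarrow>\<^sub>E X. R)"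
    by (subst sum.swap) (intro sum_mono R)
  also have "\<dots> = of_nat (card X ^ card I) * R"
    using I by (simp add: card_funcsetE)
  also have "card X ^ card I = N * card X"
    unfolding N_def using I False by (intro power_minus_mult[symmetric]) (simp add: card_gt_0_iff)
  finally have "of_nat N * (of_nat (card I) * s) \<le> of_nat N * (of_nat (card X) * R)"
    by (simp add: mult_ac)
  moreover have "N > 0" using X by (simp add: N_def card_gt_0_iff)
  ultimately show ?thesis
    by (subst (asm) ennreal_mult_le_mult_iff) auto
qed simp

section \<open>Geometric widths and their Gram matrix\<close>

lemma exp_half_le: "exp (1 / 2 :: real) \<le> 7 / 4"
proof (rule power2_le_imp_le)
  have "(exp (1 / 2 :: real))\<^sup>2 = exp 1" by (simp flip: exp_double)
  then show "(exp (1 / 2 :: real))\<^sup>2 \<le> (7 / 4)\<^sup>2"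
    using exp_le by (simp add: power2_eq_square)
qed simp

text \<open>Consecutive widths differ by the factor \<open>4 ^ J\<close>, large enough that the
  hats are nearly orthogonal; their squared norms all have the order \<open>ln (J + 1)\<close>.\<close>

definition hat_width :: "nat \<Rightarrow> nat \<Rightarrow> nat" where
  "hat_width J j = 2 * 4 ^ (J * j)"

text \<open>The 8 makes twice width times squared height equal to
  \<open>\<sigma>\<^sup>2 * ln (J + 1) / 2\<close>, so a diagonal Gram exponential is at most sqrt
  (J + 1), and the whole diagonal stays within order J^2.\<close>

definition hat_height :: "nat \<Rightarrow> real \<Rightarrow> nat \<Rightarrow> real" where
  "hat_height J \<sigma> j = \<sigma> * sqrt (ln (real J + 1) / 8) / 2 ^ (J * j)"

lemma hat_height_nonneg: "0 \<le> \<sigma> \<Longrightarrow> 0 \<le> hat_height J \<sigma> j"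
  by (simp add: hat_height_def)

lemma hat_height_square_width:
  "(hat_height J \<sigma> j)\<^sup>2 * real (hat_width J j) / 3 = \<sigma>\<^sup>2 * ln (real J + 1) / 12"
proof -
  have "(4::real) ^ (J * j) = (2 ^ (J * j))\<^sup>2"
    unfolding power2_eq_square by (subst power_mult_distrib[symmetric]) simp
  then show ?thesis
    by (simp add: hat_height_def hat_width_def power_mult_distrib power_divide)
qed

lemma hat_width_bounds:
  assumes "j < J" "4 ^ (J * J) \<le> m"
  shows "2 \<le> hat_width J j" "hat_width J j < m"
proof -
  show "2 \<le> hat_width J j" by (simp add: hat_width_def)
  have "J * j + 1 \<le> J * J"
  proof -
    have "J * (j + 1) \<le> J * J" using assms(1) by (intro mult_le_mono2) simp
    then show ?thesis using assms(1) by (simp add: algebra_simps)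
  qed
  then have "(4::nat) ^ (J * j + 1) \<le> 4 ^ (J * J)" by (intro power_increasing) auto
  then have "4 * 4 ^ (J * j) \<le> m" using assms(2) by simp
  moreover have "(0::nat) < 4 ^ (J * j)" by simp
  ultimately show "hat_width J j < m" unfolding hat_width_def by linarith
qed

text \<open>For j \<le> l the narrower width and both heights give ln (J + 1) / 2 divided by 2 ^ (J
  * (l - j)); off the diagonal this is at most 1/2 because ln (J + 1) \<le> J \<le> 2 ^ J. The other
  order follows by symmetry.\<close>

lemma hat_gram_le:
  assumes "0 < \<sigma>" "finite S"
  shows "(\<Sum>i\<in>S. hat (hat_height J \<sigma> j) (hat_width J j) (real i - real c)
        * hat (hat_height J \<sigma> l) (hat_width J l) (real i - real c)) / \<sigma>\<^sup>2
    \<le> (if j = l then ln (real J + 1) / 2 else 1 / 2)" (is "?G / _ \<le> _")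
proof -
  have *: "2 * real (min (hat_width J j) (hat_width J l)) * (hat_height J \<sigma> j * hat_height J \<sigma> l)
      \<le> \<sigma>\<^sup>2 * (if j = l then ln (real J + 1) / 2 else 1 / 2)" if le: "j \<le> l" for j l
  proof -
    obtain d where l: "l = j + d" using le_Suc_ex[OF le] by blast
    have four: "(4::real) ^ (J * j) = 2 ^ (J * j) * 2 ^ (J * j)"
      by (subst power_mult_distrib[symmetric]) simp
    have pow: "(2::real) ^ (J * l) = 2 ^ (J * j) * 2 ^ (J * d)"
      unfolding l by (simp only: distrib_left power_add)
    have "(4::nat) ^ (J * j) \<le> 4 ^ (J * l)"
      using le by (intro power_increasing mult_le_mono2) auto
    then have min: "min (hat_width J j) (hat_width J l) = hat_width J j"
      unfolding hat_width_def by (intro min_absorb1 mult_le_mono2)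
    have eq: "2 * (2 * (p * p)) * (\<sigma> * s / p * (\<sigma> * s / (p * q))) = \<sigma>\<^sup>2 * (4 * s\<^sup>2 / q)"
      if "p > 0" "q > 0" for p q s :: real
      using that by (simp add: power2_eq_square)
    have "2 * real (min (hat_width J j) (hat_width J l)) * (hat_height J \<sigma> j * hat_height J \<sigma> l)
      = \<sigma>\<^sup>2 * (4 * (sqrt (ln (real J + 1) / 8))\<^sup>2 / 2 ^ (J * d))"
      unfolding min hat_height_def pow unfolding hat_width_def of_nat_mult of_nat_power of_nat_numeral four
      by (rule eq) auto
    also have "\<dots> = \<sigma>\<^sup>2 * (ln (real J + 1) / 2 / 2 ^ (J * d))"
      by simp
    also have "\<dots> \<le> \<sigma>\<^sup>2 * (if j = l then ln (real J + 1) / 2 else 1 / 2)"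
    proof (rule mult_left_mono)
      show "ln (real J + 1) / 2 / 2 ^ (J * d) \<le> (if j = l then ln (real J + 1) / 2 else 1 / 2)"
      proof (cases "d = 0")
        case False
        have "ln (real J + 1) \<le> real J"
          using ln_add_one_self_le_self[of "real J"] by (simp add: add.commute)
        also have "real J \<le> 2 ^ J" by (rule less_imp_le[OF of_nat_less_two_power])
        also have "\<dots> \<le> 2 ^ (J * d)" using False by (intro power_increasing) auto
        finally have "ln (real J + 1) / 2 ^ (J * d) \<le> 1" by simp
        then show ?thesis using False l by simp
      qed (simp add: l)
    qed simp
    finally show ?thesis .
  qed
  have "?G \<le> 2 * real (min (hat_width J j) (hat_width J l)) * (hat_height J \<sigma> j * hat_height J \<sigma> l)"
    using assms by (intro hat_inner_le) (auto simp: hat_width_def hat_height_nonneg)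
  also have "\<dots> \<le> \<sigma>\<^sup>2 * (if j = l then ln (real J + 1) / 2 else 1 / 2)"
  proof (cases "j \<le> l")
    case True
    then show ?thesis by (rule *)
  next
    case False
    then have "l \<le> j" by simp
    from *[OF this] False show ?thesis
      by (subst min.commute, subst mult.commute[of "hat_height J \<sigma> j"]) simp
  qed
  finally show ?thesis using assms by (simp add: divide_le_eq mult.commute)
qed

text \<open>The constant is 3/2 + 7/4: the diagonal adds J * sqrt (J + 1) \<le> 3/2 * J^2, and every
  entry is charged the bound 7/4 for exp (1/2).\<close>

lemma sum_exp_gram_le:
  fixes G :: "nat \<Rightarrow> nat \<Rightarrow> real"
  assumes J: "0 < J"
    and G: "\<And>j l. j < J \<Longrightarrow> l < J \<Longrightarrow> G j l \<le> (if j = l then ln (real J + 1) / 2 else 1 / 2)"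
  shows "(\<Sum>j<J. \<Sum>l<J. exp (G j l)) \<le> 13 / 4 * (real J)\<^sup>2"
proof -
  have sq: "exp (ln (real J + 1) / 2) = sqrt (real J + 1)"
    by (subst ln_sqrt[symmetric]) auto
  have "exp (G j l) \<le> (if j = l then sqrt (real J + 1) else 0) + 7 / 4" if "j < J" "l < J" for j l
  proof -
    have "exp (G j l) \<le> exp (if j = l then ln (real J + 1) / 2 else 1 / 2)"
      using G[OF that] by (simp only: exp_le_cancel_iff)
    also have "\<dots> \<le> (if j = l then sqrt (real J + 1) else 0) + 7 / 4"
      using exp_half_le by (simp add: sq)
    finally show ?thesis .
  qed
  then have "(\<Sum>j<J. \<Sum>l<J. exp (G j l))
      \<le> (\<Sum>j<J. \<Sum>l<J. (if j = l then sqrt (real J + 1) else 0) + 7 / 4)"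
    by (intro sum_mono) auto
  also have "\<dots> = real J * sqrt (real J + 1) + 7 / 4 * (real J)\<^sup>2"
    by (simp add: sum.distrib power2_eq_square algebra_simps)
  also have "sqrt (real J + 1) \<le> 3 / 2 * real J"
  proof (rule real_le_lsqrt)
    have "real J \<ge> 1" using J by simp
    moreover from this have "real J * 1 \<le> real J * real J" by (intro mult_left_mono) auto
    moreover have "(3 / 2 * real J)\<^sup>2 = 9 / 4 * (real J * real J)" by (simp add: power2_eq_square)
    ultimately show "real J + 1 \<le> (3 / 2 * real J)\<^sup>2" by linarith
  qed simp
  finally show ?thesis
    by (simp add: power2_eq_square mult_left_mono)
qed

subsection \<open>Lower bound\<close>


text \<open>Distances are taken in \<open>int\<close> because subtraction of naturals truncates.
  Each block contains the visible support of every hat of width below \<open>m\<close> at its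
  centre.\<close>

definition block :: "nat \<Rightarrow> nat \<Rightarrow> nat \<Rightarrow> nat \<Rightarrow> nat set" where
  "block n m B b = {i \<in> {1..n}. \<bar>int i - int (block_centre n m B b)\<bar> < int m}"

lemma disjoint_blocks:
  assumes "2 * m * B \<le> n"
  shows "disjoint_family_on (block n m B) {..<B}"
proof -
  have far: "block_centre n m B b + 2 * m \<le> block_centre n m B b'" if lt: "b < b'" "b' < B" for b b'
  proof -
    obtain d where "b' = b + Suc d" using less_imp_Suc_add[OF lt(1)] by auto
    then show ?thesis using block_centre_add[OF assms, of b "Suc d"] lt by simp
  qed
  have "block n m B b \<inter> block n m B b' = {}" if lt: "b < b'" "b' < B" for b b'
    using far[OF lt] unfolding block_def by auto
  then show ?thesis
    unfolding disjoint_family_on_def by (metis Int_commute lessThan_iff linorder_neqE_nat)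
qed

text \<open>In every block an index below \<open>2 * J\<close> is drawn uniformly, the indices from \<open>J\<close> on
  standing for the absence of a hat, so that a fixed null vector has weight 1/2.\<close>

lemma block_minimax_lower_bound:
  assumes \<sigma>: "0 < \<sigma>" and J: "0 < J" and B: "0 < B" and m: "4 ^ (J * J) \<le> m"
    and n: "2 * m * B \<le> n" and k: "3 * B \<le> k + 1" and T: "T \<in> estimators n"
  shows "ennreal (real B * \<sigma>\<^sup>2 * ln (real J + 1) / 256) \<le> (SUP \<theta>\<in>Theta_star n k. sq_risk n \<sigma> T \<theta>)"
proof -
  define h where "h x = (if x < J then hat_height J \<sigma> x else 0)" for x
  \<comment> \<open>An absent hat gets height 0 and the dummy width 2, which keeps the knots
    legal.\<close>
  define w where "w x = (if x < J then hat_width J x else 2)" for x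
  define A where "A = \<sigma> * sqrt (ln (real J + 1) / 8)"
  define c where "c = block_centre n m B"
  define \<theta> where "\<theta> g = (\<lambda>i\<in>{1..n}. \<Sum>b<B. A * \<bar>real i - real (c b)\<bar> + hat (h (g b)) (w (g b)) (real i - real (c b)))"
    for g :: "nat \<Rightarrow> nat"
  define D where "D = \<sigma>\<^sup>2 * ln (real J + 1) / 24"
  define S where "S = block n m B"
  define R where "R = (SUP \<theta>\<in>Theta_star n k. sq_risk n \<sigma> T \<theta>)"
  have "(4::nat) ^ 1 \<le> 4 ^ (J * J)" using J by (intro power_increasing) auto
  then have m4: "4 \<le> m" using m by simp
  have w: "2 \<le> w x \<and> w x < m" for x
    using hat_width_bounds[OF _ m, of x] m4 by (auto simp: w_def)
  have A: "0 \<le> A" using \<sigma> by (simp add: A_def)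
  have h: "0 \<le> h x \<and> h x \<le> A * real (w x)" for x
  proof -
    \<comment> \<open>\<open>A\<close> is the height of the narrowest hat, hence the largest height;
      as widths are at least 1 it also bounds every flank slope.\<close>
    have "A * 1 \<le> A * 2 ^ (J * x)"
      using A by (intro mult_left_mono one_le_power) auto
    then have "h x \<le> A * 1"
      using A by (simp add: h_def hat_height_def A_def[symmetric] divide_le_eq)
    also have "A * 1 \<le> A * real (w x)"
      using A w[of x] by (intro mult_left_mono) auto
    finally show ?thesis using \<sigma> by (simp add: h_def hat_height_nonneg)
  qed
  have \<theta>_in: "\<theta> g \<in> Theta_star n k" for g
    unfolding \<theta>_def c_def using w h by (intro sum_abs_plus_hat_in_Theta_star[OF B n k]) auto
  have S_sub: "S b \<subseteq> {1..n}" for b by (auto simp: S_def block_def)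
  have null: "hat (h J) (w J) t = 0" for t by (simp add: h_def hat_def)
  \<comment> \<open>The steep base and the hats at all other centres cancel, so the bound for block
    \<open>b\<close> does not depend on \<open>g\<close>.\<close>
  have diff: "\<theta> (g(b := x)) i - \<theta> (g(b := J)) i = hat (h x) (w x) (real i - real (c b))"
    if b: "b < B" and i: "i \<in> {1..n}" for g b x i
  proof -
    have "\<theta> (g(b := x)) i - \<theta> (g(b := J)) i
        = (\<Sum>b'<B. if b' = b then hat (h x) (w x) (real i - real (c b)) else 0)"
      unfolding \<theta>_def using i
      by (simp only: restrict_apply' sum_subtractf[symmetric]) (intro sum.cong refl, simp add: null)
    then show ?thesis using b by simp
  qed
  have step: "ennreal (3 / 16 * D * real J) \<le> (\<Sum>x<2 * J. block_risk n \<sigma> (S b) T (\<theta> (g(b := x))))"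
    if b: "b < B" for b g
  proof -
    have sep: "2 * D \<le> (\<Sum>i\<in>S b. (\<theta> (g(b := j)) i - \<theta> (g(b := J)) i)\<^sup>2)" if j: "j < J" for j
    proof -
      have "2 * D = (h j)\<^sup>2 * real (w j) / 3"
        using j by (simp add: h_def w_def hat_height_square_width D_def)
      also have "\<dots> \<le> (\<Sum>i\<in>S b. (hat (h j) (w j) (real i - real (c b)))\<^sup>2)"
      proof (rule hat_energy)
        note cb = block_centre_bounds[OF n b]
        show "0 < w j" "w j \<le> c b" using w[of j] cb unfolding c_def by linarith+
        show "finite (S b)" by (rule finite_subset[OF S_sub]) simp
        show "{c b - w j<..c b} \<subseteq> S b"
          using w[of j] cb by (auto simp: S_def block_def c_def)
      qed
      also have "\<dots> = (\<Sum>i\<in>S b. (\<theta> (g(b := j)) i - \<theta> (g(b := J)) i)\<^sup>2)"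
        using S_sub[of b] by (intro sum.cong refl) (subst diff[OF b], auto)
      finally show ?thesis .
    qed
    have gram: "(\<Sum>i\<in>{1..n}. (\<theta> (g(b := j)) i - \<theta> (g(b := J)) i) * (\<theta> (g(b := l)) i - \<theta> (g(b := J)) i)) / \<sigma>\<^sup>2
        \<le> (if j = l then ln (real J + 1) / 2 else 1 / 2)" if "j < J" "l < J" for j l
    proof -
      have "(\<Sum>i\<in>{1..n}. (\<theta> (g(b := j)) i - \<theta> (g(b := J)) i) * (\<theta> (g(b := l)) i - \<theta> (g(b := J)) i))
        = (\<Sum>i\<in>{1..n}. hat (hat_height J \<sigma> j) (hat_width J j) (real i - real (c b))
          * hat (hat_height J \<sigma> l) (hat_width J l) (real i - real (c b)))"
        using that by (intro sum.cong refl) (subst (1 2) diff[OF b], auto simp: h_def w_def)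
      then show ?thesis using hat_gram_le[OF \<sigma>, of "{1..n}" J j "c b" l] by simp
    qed
    have "0 \<le> D" by (simp add: D_def)
    then have "ennreal (3 / 16 * D * real J) \<le> of_nat J * block_risk n \<sigma> (S b) T (\<theta> (g(b := J)))
        + (\<Sum>x<J. block_risk n \<sigma> (S b) T (\<theta> (g(b := x))))"
    proof (rule mixture_block_risk[OF \<sigma> T S_sub])
      show "(\<Sum>j<J. \<Sum>l<J. exp ((\<Sum>i\<in>{1..n}. (\<theta> (g(b := j)) i - \<theta> (g(b := J)) i)
          * (\<theta> (g(b := l)) i - \<theta> (g(b := J)) i)) / \<sigma>\<^sup>2)) \<le> 13 / 4 * (real J)\<^sup>2"
        by (rule sum_exp_gram_le[OF J gram])
    qed (rule sep)
    moreover have "of_nat J * block_risk n \<sigma> (S b) T (\<theta> (g(b := J)))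
        = (\<Sum>x=J..<2 * J. block_risk n \<sigma> (S b) T (\<theta> (g(b := x))))"
    proof -
      have "\<theta> (g(b := x)) = \<theta> (g(b := J))" if x: "x \<in> {J..<2 * J}" for x
      proof -
        have "h x = h J" "w x = w J" using x by (simp_all add: h_def w_def)
        then have "h ((g(b := x)) b') = h ((g(b := J)) b')" "w ((g(b := x)) b') = w ((g(b := J)) b')" for b'
          by simp_all
        then show ?thesis unfolding \<theta>_def by (simp only:)
      qed
      then have "(\<Sum>x=J..<2 * J. block_risk n \<sigma> (S b) T (\<theta> (g(b := x))))
          = (\<Sum>x=J..<2 * J. block_risk n \<sigma> (S b) T (\<theta> (g(b := J))))"
        by (intro sum.cong refl arg_cong[of _ _ "block_risk n \<sigma> (S b) T"]) blast
      then show ?thesis by simp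
    qed
    moreover have "(\<Sum>x=J..<2 * J. block_risk n \<sigma> (S b) T (\<theta> (g(b := x))))
        + (\<Sum>x<J. block_risk n \<sigma> (S b) T (\<theta> (g(b := x))))
        = (\<Sum>x<2 * J. block_risk n \<sigma> (S b) T (\<theta> (g(b := x))))"
      using sum.atLeastLessThan_concat[of 0 J "2 * J" "\<lambda>x. block_risk n \<sigma> (S b) T (\<theta> (g(b := x)))"]
      by (simp add: add.commute atLeast0LessThan)
    ultimately show ?thesis by (simp only:)
  qed
  have "of_nat (card {..<B}) * ennreal (3 / 16 * D * real J) \<le> of_nat (card {..<2 * J}) * R"
  proof (rule prior_average_le[where r = "\<lambda>b g. block_risk n \<sigma> (S b) T (\<theta> g)"])
    fix b g assume "b \<in> {..<B}"
    then show "ennreal (3 / 16 * D * real J) \<le> (\<Sum>x<2 * J. block_risk n \<sigma> (S b) T (\<theta> (g(b := x))))"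
      by (intro step) simp
  next
    fix g
    have "(\<Sum>b<B. block_risk n \<sigma> (S b) T (\<theta> g)) \<le> sq_risk n \<sigma> T (\<theta> g)"
      unfolding S_def using S_sub[unfolded S_def] disjoint_blocks[OF n]
      by (intro sum_block_risk_le_sq_risk[OF T]) auto
    also have "\<dots> \<le> R" unfolding R_def by (intro SUP_upper \<theta>_in)
    finally show "(\<Sum>b<B. block_risk n \<sigma> (S b) T (\<theta> g)) \<le> R" .
  qed (use J in \<open>auto simp: lessThan_empty_iff\<close>)
  moreover have "of_nat (card {..<B}) * ennreal (3 / 16 * D * real J)
      = of_nat (2 * J) * ennreal (real B * \<sigma>\<^sup>2 * ln (real J + 1) / 256)"
  proof -
    \<comment> \<open>3/16 times the 1/24 in \<open>D\<close> is 1/128; null and alternatives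
      together count 2J indices, which halves it to 1/256.\<close>
    have "real B * (3 / 16 * D * real J) = real (2 * J) * (real B * \<sigma>\<^sup>2 * ln (real J + 1) / 256)"
      by (simp add: D_def)
    moreover have "0 \<le> D" by (simp add: D_def)
    ultimately show ?thesis
      by (simp only: ennreal_of_nat_eq_real_of_nat card_lessThan ennreal_mult'[symmetric] of_nat_0_le_iff)
  qed
  ultimately have "of_nat (2 * J) * ennreal (real B * \<sigma>\<^sup>2 * ln (real J + 1) / 256) \<le> of_nat (2 * J) * R"
    by simp
  moreover have "(of_nat (2 * J) :: ennreal) \<noteq> 0" using J by simp
  ultimately show ?thesis
    unfolding R_def[symmetric] by (subst (asm) ennreal_mult_le_mult_iff) (auto simp: ennreal_of_nat_eq_real_of_nat)
qed

section \<open>Choice of the numbers of blocks and widths\<close>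

text \<open>Maximality of \<open>J\<close> gives x \<le> 4 ^ (s + 2) with s = (J + 1)^2 \<ge> 4,
  hence ln x \<le> 2 (s + 2) \<le> 4 s \<le> s^2 = (J + 1)^4.\<close>

lemma ln_ln_le:
  fixes J m :: nat and x :: real
  assumes J: "0 < J" and m: "m < 4 ^ ((J + 1) * (J + 1))" and x: "1 < x" "x \<le> 16 * (real m + 1)"
  shows "ln (ln x) \<le> 4 * ln (real J + 1)"
proof -
  define s where "s = (real J + 1)\<^sup>2"
  have "4 \<le> s"
    unfolding s_def using J power_mono[of 2 "real J + 1" 2] by simp
  then have s2: "4 * s \<le> s * s" by (intro mult_right_mono) auto
  have "real m + 1 \<le> 4 ^ ((J + 1) * (J + 1))"
    using of_nat_mono[OF Suc_leI[OF m], where ?'a = real] by simp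
  then have "x \<le> 4 ^ ((J + 1) * (J + 1) + 2)"
    using x by simp
  then have "ln x \<le> ln (4 ^ ((J + 1) * (J + 1) + 2))"
    using x by (intro ln_mono) auto
  also have "\<dots> = real ((J + 1) * (J + 1) + 2) * ln 4"
    by (rule ln_realpow)
  also have "real ((J + 1) * (J + 1) + 2) = s + 2"
    by (simp add: s_def power2_eq_square algebra_simps)
  also have "ln (4::real) \<le> 2"
  proof -
    have "ln (2::real) \<le> 1" using ln_add_one_self_le_self[of "1::real"] by simp
    moreover have "ln (4::real) = 2 * ln 2" using ln_realpow[of "2::real" 2] by simp
    ultimately show ?thesis by simp
  qed
  then have "(s + 2) * ln 4 \<le> (s + 2) * 2"
    using \<open>4 \<le> s\<close> by (intro mult_left_mono) auto
  also have "\<dots> \<le> 4 * s" using \<open>4 \<le> s\<close> by simp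
  also note s2
  also have "s * s = (real J + 1) ^ 4"
    by (simp add: s_def power2_eq_square power4_eq_xxxx)
  finally have "ln x \<le> (real J + 1) ^ 4" .
  then have "ln (ln x) \<le> ln ((real J + 1) ^ 4)"
    using x by (intro ln_mono) auto
  then show ?thesis by (simp add: ln_realpow)
qed

theorem proposition3p2:
  "\<exists>c::real. c > 0 \<and> (\<exists>n0::nat. \<forall>n\<ge>n0. \<forall>k::nat. 2 \<le> k \<and> k \<le> n \<longrightarrow> (\<forall>\<sigma>::real. \<sigma> > 0 \<longrightarrow>
     (INF T\<in>estimators n. SUP \<theta>\<in>Theta_star n k. sq_risk n \<sigma> T \<theta>)
       \<ge> ennreal (c * \<sigma>\<^sup>2 * real k * ln (ln (16 * real n / real k)))))"
proof (intro exI[of _ "1 / 24576 :: real"] conjI exI[of _ "50 :: nat"] allI impI INF_greatest)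
  fix n k :: nat and \<sigma> :: real and T
  assume n: "50 \<le> n" and k: "2 \<le> k \<and> k \<le> n" and \<sigma>: "0 < \<sigma>" and T: "T \<in> estimators n"
  \<comment> \<open>The offset makes B positive from k = 2 on. The divisor 12 is more than the piece
    budget 3B \<le> k + 1 demands: it keeps blocks long even when k = n.\<close>
  define B where "B = (k + 10) div 12"
  define m where "m = n div (2 * B)"
  have B: "0 < B" using k by (simp add: B_def div_greater_zero_iff)
  have B12: "12 * B \<le> k + 10" "k < 12 * B + 2"
    unfolding B_def by presburger+
  \<comment> \<open>This is where 50 enters: B \<le> (n + 10) / 12 yields 10 B \<le> n once n \<ge>
    50. Then m \<ge> 4, so at least the single width J = 1 fits.\<close>
  have "10 * B \<le> n" using B12 k n by linarith
  then have "5 * (2 * B) div (2 * B) \<le> m" unfolding m_def by (intro div_le_mono) simp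
  then have m4: "4 \<le> m" using B by simp
  have n_m: "2 * m * B \<le> n" "n < 2 * B * (m + 1)"
  proof -
    show "2 * m * B \<le> n"
      unfolding m_def using div_times_less_eq_dividend[of n "2 * B"] by (simp add: mult_ac)
    show "n < 2 * B * (m + 1)"
      unfolding m_def using dividend_less_div_times[of "2 * B" n] B by (simp add: mult_ac algebra_simps)
  qed
  have le_4: "j * j \<le> m" if "4 ^ (j * j) \<le> m" for j
    using that less_exp[of "j * j"] power_mono[of "2::nat" 4 "j * j"] by linarith
  define P where "P j \<longleftrightarrow> 4 ^ (j * j) \<le> m" for j :: nat
  define J where "J = Greatest P"
  have bound: "j \<le> m" if "P j" for j
    using le_4[of j] that le_square[of j] unfolding P_def by linarith
  have one: "P 1" using m4 by (simp add: P_def)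
  have "P J" unfolding J_def by (rule GreatestI_nat[of P, OF one bound])
  have "1 \<le> J" unfolding J_def by (rule Greatest_le_nat[of P, OF one bound])
  have J_less: "m < 4 ^ ((J + 1) * (J + 1))"
  proof (rule ccontr)
    assume "\<not> ?thesis"
    then have "P (J + 1)" by (simp only: P_def not_less)
    then have "J + 1 \<le> J" unfolding J_def by (rule Greatest_le_nat[of P, OF _ bound])
    then show False by simp
  qed
  have J_le: "4 ^ (J * J) \<le> m" "1 \<le> J"
    using \<open>P J\<close> \<open>1 \<le> J\<close> by (simp_all only: P_def)
  define x where "x = 16 * real n / real k"
  have x1: "1 < x" unfolding x_def using k n by (simp add: less_divide_eq)
  have "2 * B \<le> k" using B12 k by linarith
  then have "2 * B * (m + 1) \<le> k * (m + 1)" by (rule mult_le_mono1)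
  then have "n \<le> k * (m + 1)" using n_m by linarith
  then have "real n \<le> real k * (real m + 1)" using of_nat_mono[of n "k * (m + 1)", where ?'a = real]
    by (simp add: distrib_left)
  then have x2: "x \<le> 16 * (real m + 1)"
    unfolding x_def using k by (simp add: divide_le_eq algebra_simps)
  have lnln: "ln (ln x) \<le> 4 * ln (real J + 1)"
    using J_le J_less x1 x2 by (intro ln_ln_le) auto
  \<comment> \<open>24576 = 256 * 24 * 4, from the block bound, k \<le> 24 B and the factor 4 in the
    comparison of logarithms.\<close>
  have "1 / 24576 * \<sigma>\<^sup>2 * real k * ln (ln x) \<le> 1 / 24576 * \<sigma>\<^sup>2 * real k * (4 * ln (real J + 1))"
    using lnln by (intro mult_left_mono) auto
  also have "\<dots> \<le> 1 / 24576 * \<sigma>\<^sup>2 * (24 * real B) * (4 * ln (real J + 1))"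
    using B12 B by (intro mult_right_mono mult_left_mono) auto
  also have "\<dots> = real B * \<sigma>\<^sup>2 * ln (real J + 1) / 256" by simp
  finally have "ennreal (1 / 24576 * \<sigma>\<^sup>2 * real k * ln (ln x))
      \<le> ennreal (real B * \<sigma>\<^sup>2 * ln (real J + 1) / 256)"
    by (rule ennreal_leI)
  also have "\<dots> \<le> (SUP \<theta>\<in>Theta_star n k. sq_risk n \<sigma> T \<theta>)"
    using \<sigma> J_le B n_m T B12 k by (intro block_minimax_lower_bound[where m = m]) auto
  finally show "ennreal (1 / 24576 * \<sigma>\<^sup>2 * real k * ln (ln (16 * real n / real k)))
      \<le> (SUP \<theta>\<in>Theta_star n k. sq_risk n \<sigma> T \<theta>)"
    unfolding x_def .
qed simp

end
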